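(* Let $0<q<1$, let $0<s_{1}(q)<s_{2}(q)<s_{3}(q)<\dots$ be all positive zeros of $\mathcal{S}_{q}$, and put $s_{-k}(q)=-s_{k}(q)$ for $k\in\mathbb{N}$. The orthogonality relation $$(1-q)P_{n}(0;q)P_{m}(0;q)-\sum_{k\in\mathbb{Z}\setminus\{0\}}\frac{\mathcal{S}_{q}(qs_{k}(q))}{s_{k}(q)\,\mathcal{S}_{q}'(s_{k}(q))}\,P_{n}\left(q^{1/2}s_{k}(q);q\right)P_{m}\left(q^{1/2}s_{k}(q);q\right)=\delta_{mn}$$ holds for all $m,n\in\mathbb{Z}_{+}=\{0,1,2,\dots\}$.
   Context: Here $0<q<1$ and fractional powers of $q$ are positive reals. $(a;q)_{n}=\prod_{k=0}^{n-1}(1-aq^{k})$. The polynomials $P_n(x;q)$ are determined by $P_{0}(x;q)=1$, $P_1(x;q)=x$ and $$q^{-(n-1)/2}P_{n-1}(x;q)+q^{-n/2}P_{n+1}(x;q)=xP_{n}(x;q),\quad n\ge1.$$ The $q$-sine is the entire function $\mathcal{S}_{q}(z)=\sum_{n=0}^{\infty}\frac{(-1)^{n}q^{n(n+1)}}{(q;q)_{2n+1}}z^{2n+1}$; it has infinitely many zeros, all of them real and simple. *)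

theory Defs
  imports "HOL-Complex_Analysis.Complex_Analysis" "HOL-Computational_Algebra.Polynomial"
begin

definition qpoch :: "real \<Rightarrow> real \<Rightarrow> nat \<Rightarrow> real" where
  "qpoch a q n = (\<Prod>k<n. 1 - a * q ^ k)"

(* The defining recurrence is solved for its highest-index term; qP_recurrence recovers
   the symmetric form. *)
fun qP :: "real \<Rightarrow> nat \<Rightarrow> real poly" where
  "qP q 0 = 1"
| "qP q (Suc 0) = [:0, 1:]"
| "qP q (Suc (Suc n)) =
     smult (q powr (real (Suc n) / 2))
       ([:0, 1:] * qP q (Suc n) - smult (q powr (- real n / 2)) (qP q n))"

lemma qP_recurrence:
  assumes "0 < q" and "1 \<le> n"
  shows "q powr (- (real n - 1) / 2) * poly (qP q (n - 1)) x
           + q powr (- real n / 2) * poly (qP q (n + 1)) x = x * poly (qP q n) x"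
proof -
  obtain m where n: "n = Suc m"
    using assms(2) by (cases n) auto
  have inv: "q powr (- real n / 2) * q powr (real n / 2) = 1"
    using assms(1) by (simp flip: powr_add)
  have "q powr (- real n / 2) * poly (qP q (n + 1)) x
          = (q powr (- real n / 2) * q powr (real n / 2))
              * (x * poly (qP q n) x - q powr (- real m / 2) * poly (qP q m) x)"
    by (simp add: n mult.assoc)
  also have "\<dots> = x * poly (qP q n) x - q powr (- real m / 2) * poly (qP q m) x"
    by (simp only: inv mult_1)
  finally have step: "q powr (- real n / 2) * poly (qP q (n + 1)) x
      = x * poly (qP q n) x - q powr (- real m / 2) * poly (qP q m) x" .
  have "n - 1 = m" and "real n - 1 = real m"
    by (simp_all add: n)
  then show ?thesis
    by (simp only: step)
qed

definition qsin :: "real \<Rightarrow> complex \<Rightarrow> complex" where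
  "qsin q z =
     (\<Sum>n. of_real ((-1) ^ n * q ^ (n * (n + 1)) / qpoch q q (2 * n + 1)) * z ^ (2 * n + 1))"

end

theory Submission
  imports Defs
begin

text \<open>
  The polynomials are those of a Jacobi matrix whose off-diagonal entries \<open>q powr (- n / 2)\<close> grow so
  fast that every solution of the recurrence is square-summable. The measure in the theorem belongs
  to one self-adjoint extension of this matrix, and its atoms are the eigenvalues. No spectral
  theory is used below: the relation is a residue computation.

  With \<open>S\<close> the \<open>q\<close>-sine and \<open>C\<close> the \<open>q\<close>-cosine at the argument \<open>q powr (1/2) * z\<close>, one has
  \<open>S z - S (q * z) = z * C z\<close> and \<open>C z - C (q * z) = - q * z * S (q * z)\<close>. Therefore suitable multiples
  \<open>Psi n\<close> of \<open>C (q ^ k * z)\<close> (for \<open>n = 2 * k\<close>) and \<open>S (q ^ (k + 1) * z)\<close> (for \<open>n = 2 * k + 1\<close>) solve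
  the recurrence at \<open>x = q powr (1/2) * z\<close>. This solution continues to index \<open>-1\<close> with the
  value \<open>S z\<close>; so at a zero of \<open>S\<close> one has \<open>Psi n z = C z * P\<^sub>n(x)\<close> (\<open>Psi_at_zero\<close>). The
  weight at a zero \<open>z\<close>, including the weight \<open>1 - q\<close> at \<open>z = 0\<close>, equals \<open>C z / deriv S z\<close>.
  Hence weight times \<open>P\<^sub>n\<close> is the residue of
  \<open>Psi n / S\<close>, and the sum over the zeros in a disc is a contour integral of \<open>Psi n / S\<close>.

  On circles of radius \<open>\<rho> / q ^ N\<close>, the rescaled sine converges uniformly to a theta function, so
  for a suitable \<open>\<rho>\<close> it stays away from 0, and \<open>S z\<close> dominates \<open>S (q ^ b * z)\<close> for \<open>b > 0\<close>
  (\<open>separating_radius_exists\<close>, \<open>separating_radius_decay\<close>). Consequently the integrals tend to 1 for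
  \<open>n = 0\<close> and to 0 for \<open>n > 0\<close> (\<open>Psi_residue_sum_tendsto\<close>), and the recurrence extends this to all
  products \<open>P\<^sub>n P\<^sub>m\<close>.

  Two points remain. The residues have to sit at simple real zeros, and the sum is unordered. A
  Christoffel--Darboux identity (\<open>casorati_iterate\<close>) gives that the zeros are real, and its
  confluent form gives \<open>C z * deriv S z > 0\<close> there; thus the zeros are simple and the weights
  positive. Positivity turns convergence along the discs into absolute convergence.
\<close>

section \<open>Series dominated by powers of q, and sums along exhaustions\<close>

text \<open>The general term is the \<open>n\<close>-th power of \<open>q ^ n * (q * r)\<close>,
  which tends to 0: the series beats every geometric one.\<close>
lemma summable_theta_powers:
  fixes q r :: real
  assumes "0 < q" "q < 1" "0 \<le> r"
  shows "summable (\<lambda>n. q ^ (n * (n + 1)) * r ^ n)"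
proof -
  have "(\<lambda>n. q ^ n * (q * r)) \<longlonglongrightarrow> 0"
    using assms by (auto intro!: tendsto_mult_left_zero LIMSEQ_power_zero)
  then have "eventually (\<lambda>n. q ^ n * (q * r) < 1/2) sequentially"
    by (rule order_tendstoD) simp
  then have ev: "eventually (\<lambda>n. norm (q ^ (n * (n + 1)) * r ^ n) \<le> (1/2) ^ n) sequentially"
  proof eventually_elim
    case (elim n)
    have "q ^ (n * (n + 1)) * r ^ n = (q ^ n * (q * r)) ^ n"
      by (simp add: power_mult_distrib power_add algebra_simps flip: power_mult)
    also have "\<dots> \<le> (1/2) ^ n"
      using elim assms by (intro power_mono) auto
    finally show ?case using assms by simp
  qed
  show ?thesis
    by (rule summable_comparison_test_ev[OF ev]) (simp add: summable_geometric)
qed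

lemma theta_dominated_powser:
  fixes c :: "nat \<Rightarrow> complex" and q M :: real
  assumes "0 < q" "q < 1" and bd: "\<And>n. norm (c n) \<le> M * q ^ (n * (n + 1))"
  shows "summable (\<lambda>n. c n * x ^ n)"
    and "(\<lambda>x. \<Sum>n. c n * x ^ n) holomorphic_on A"
proof -
  show *: "summable (\<lambda>n. c n * x ^ n)" for x
  proof (rule summable_comparison_test')
    show "summable (\<lambda>n. M * (q ^ (n * (n + 1)) * norm x ^ n))"
      by (intro summable_mult summable_theta_powers assms) simp
    show "norm (c n * x ^ n) \<le> M * (q ^ (n * (n + 1)) * norm x ^ n)" for n
      using mult_right_mono[OF bd[of n], of "norm x ^ n"]
      by (simp add: norm_mult norm_power mult.assoc)
  qed
  show "(\<lambda>x. \<Sum>n. c n * x ^ n) holomorphic_on A"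
    using termdiffs_strong_converges_everywhere[OF *]
    by (meson field_differentiable_at_within field_differentiable_def holomorphic_onI)
qed

text \<open>Residue sums are only controlled along the zeros inside a sequence of growing discs. For
  a family already known to be summable, such a sequence of finite sets is cofinal among the finite
  subsets, so its limit is the unordered sum.\<close>
lemma has_sum_of_exhaustion:
  fixes f :: "'a \<Rightarrow> 'b :: banach"
  assumes sm: "f summable_on A" and ex: "\<And>N. finite (X N)" "\<And>N. X N \<subseteq> A"
    "\<And>z. z \<in> A \<Longrightarrow> \<forall>\<^sub>F N in sequentially. z \<in> X N"
    and lim: "(\<lambda>N. sum f (X N)) \<longlonglongrightarrow> l"
  shows "(f has_sum l) A"
proof -
  have "filterlim X (finite_subsets_at_top A) sequentially"
    unfolding filterlim_finite_subsets_at_top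
  proof (intro allI impI)
    fix Y assume "finite Y \<and> Y \<subseteq> A"
    then have "\<forall>\<^sub>F N in sequentially. \<forall>z\<in>Y. z \<in> X N"
      by (intro eventually_ball_finite) (auto intro: ex(3))
    then show "\<forall>\<^sub>F N in sequentially. finite (X N) \<and> Y \<subseteq> X N \<and> X N \<subseteq> A"
      by eventually_elim (use ex in auto)
  qed
  moreover have hs: "(f has_sum infsum f A) A" using sm by (rule has_sum_infsum)
  ultimately have "(\<lambda>N. sum f (X N)) \<longlonglongrightarrow> infsum f A"
    unfolding has_sum_def by (rule filterlim_compose[rotated])
  then show ?thesis using hs lim LIMSEQ_unique by blast
qed

text \<open>For nonnegative terms every finite partial sum is dominated by those along the
  exhaustion, so convergence along it already gives summability.\<close>
lemma nonneg_summable_of_exhaustion: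
  fixes g :: "'a \<Rightarrow> real"
  assumes nn: "\<And>z. z \<in> A \<Longrightarrow> 0 \<le> g z" and ex: "\<And>N. finite (X N)" "\<And>N. X N \<subseteq> A"
    "\<And>z. z \<in> A \<Longrightarrow> \<forall>\<^sub>F N in sequentially. z \<in> X N"
    and lim: "(\<lambda>N. sum g (X N)) \<longlonglongrightarrow> l"
  shows "g summable_on A"
proof (rule nonneg_bdd_above_summable_on[OF nn])
  have "sum g Y \<le> l" if Y: "Y \<subseteq> A" "finite Y" for Y
  proof (rule tendsto_lowerbound[OF lim])
    have "\<forall>\<^sub>F N in sequentially. \<forall>z\<in>Y. z \<in> X N"
      using Y by (intro eventually_ball_finite) (auto intro: ex(3))
    then show "\<forall>\<^sub>F N in sequentially. sum g Y \<le> sum g (X N)"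
    proof eventually_elim
      case (elim N)
      then show ?case using nn ex by (intro sum_mono2) blast+
    qed
  qed simp
  then show "bdd_above (sum g ` {F. F \<subseteq> A \<and> finite F})"
    by (intro bdd_aboveI[of _ l]) auto
qed

section \<open>The q-sine, the q-cosine and their difference equations\<close>

locale q_trig =
  fixes q :: real
  assumes q_pos: "0 < q" and q_less_1: "q < 1"
begin

lemma qpoch_Suc: "qpoch q q (Suc n) = qpoch q q n * (1 - q ^ Suc n)"
  by (simp add: qpoch_def)

lemma qpoch_pos: "0 < qpoch q q n"
proof -
  have "q ^ Suc k < 1" for k
    using q_pos q_less_1 by (intro power_Suc_less_one) auto
  then show ?thesis
    unfolding qpoch_def by (intro prod_pos) simp
qed

lemma qpoch_nz [simp]: "qpoch q q n \<noteq> 0"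
  using qpoch_pos[of n] by simp

definition qinf :: real where "qinf = (\<Prod>k. 1 - q * q ^ k)"

text \<open>The positivity of the limit is what makes the coefficients of the \<open>q\<close>-sine
  comparable with those of a theta function.\<close>
lemma qpoch_tendsto: "qpoch q q \<longlonglongrightarrow> qinf" and qinf_pos: "0 < qinf"
proof -
  have lt: "q * q ^ k < 1" for k
    using power_Suc_less_one[of q k] q_pos q_less_1 by simp
  have "summable (\<lambda>k. norm (q * q ^ k))"
    using q_pos q_less_1 by (auto intro!: summable_mult simp: abs_mult)
  then have "summable (\<lambda>k. norm (- (q * q ^ k)))" by simp
  then have cv: "convergent_prod (\<lambda>k. 1 - q * q ^ k)"
    by (intro abs_convergent_prod_imp_convergent_prod summable_imp_abs_convergent_prod) simp
  have "(\<lambda>n. \<Prod>k\<le>n. 1 - q * q ^ k) \<longlonglongrightarrow> qinf"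
    unfolding qinf_def by (rule convergent_prod_LIMSEQ[OF cv])
  then have "(\<lambda>n. qpoch q q (Suc n)) \<longlonglongrightarrow> qinf"
    by (simp add: qpoch_def lessThan_Suc_atMost)
  then show lim: "qpoch q q \<longlonglongrightarrow> qinf"
    by (rule LIMSEQ_imp_Suc)
  have "qinf \<noteq> 0"
    unfolding qinf_def using lt by (intro prodinf_nonzero[OF cv]) (metis diff_gt_0_iff_gt less_irrefl)
  moreover have "0 \<le> qinf"
    using lim qpoch_pos by (meson LIMSEQ_le_const less_imp_le)
  ultimately show "0 < qinf" by simp
qed

lemma qinf_le_qpoch: "qinf \<le> qpoch q q n"
proof (rule decseq_ge[OF _ qpoch_tendsto])
  show "decseq (qpoch q q)"
  proof (rule decseq_SucI)
    fix n
    have "qpoch q q n * (1 - q ^ Suc n) \<le> qpoch q q n * 1"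
      using qpoch_pos[of n] q_pos by (intro mult_left_mono) auto
    then show "qpoch q q (Suc n) \<le> qpoch q q n" by (simp add: qpoch_Suc)
  qed
qed

definition S :: "complex \<Rightarrow> complex" where "S = qsin q"

text \<open>Both functions have coefficients of this form, \<open>m\<close> being
  \<open>2 * n + 1\<close> for the sine and \<open>2 * n\<close> for the cosine.\<close>
definition c :: "nat \<Rightarrow> nat \<Rightarrow> real" where
  "c n m = (-1) ^ n * q ^ (n * (n + 1)) / qpoch q q m"

text \<open>This is the \<open>q\<close>-cosine
  \<open>\<Sum>n. (-1) ^ n * q ^ (n\<^sup>2) / (q; q)\<^sub>2\<^sub>n * x ^ (2 * n)\<close> at
  \<open>x = q powr (1/2) * z\<close>. The rescaled argument makes both difference equations below
  free of fractional powers of \<open>q\<close>.\<close>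
definition C :: "complex \<Rightarrow> complex" where
  "C z = (\<Sum>n. of_real (c n (2 * n)) * (z\<^sup>2) ^ n)"

lemma coeff_bound:
  "norm (of_real (c n m) :: complex) \<le> 1 / qinf * q ^ (n * (n + 1))"
proof -
  have "norm (of_real (c n m) :: complex)
      = q ^ (n * (n + 1)) / qpoch q q m"
    unfolding norm_of_real c_def using qpoch_pos[of m] q_pos by (simp add: abs_mult power_abs)
  also have "\<dots> \<le> q ^ (n * (n + 1)) / qinf"
    using qinf_le_qpoch[of m] qinf_pos q_pos by (intro divide_left_mono) (auto intro!: mult_pos_pos qpoch_pos)
  finally show ?thesis by simp
qed

lemmas coeff_powser = theta_dominated_powser[OF q_pos q_less_1 coeff_bound]

lemma C_sums:
  "(\<lambda>n. of_real (c n (2 * n)) * z ^ (2 * n)) sums C z"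
  unfolding C_def power_mult using coeff_powser(1) by (rule summable_sums)

lemma S_sums:
  "(\<lambda>n. of_real (c n (2 * n + 1)) * z ^ (2 * n + 1)) sums S z"
    (is "?f sums _")
  and S_eq: "S z = z * (\<Sum>n. of_real (c n (2 * n + 1)) * (z\<^sup>2) ^ n)"
proof -
  have eq: "?f = (\<lambda>n. z * (of_real (c n (2 * n + 1)) * (z\<^sup>2) ^ n))"
    by (rule ext) (simp add: power_add mult_ac flip: power_mult)
  have *: "?f sums (z * (\<Sum>n. of_real (c n (2 * n + 1)) * (z\<^sup>2) ^ n))"
    unfolding eq using coeff_powser(1) by (intro sums_mult summable_sums)
  have eq': "S z = suminf ?f"
    unfolding S_def qsin_def c_def ..
  show "?f sums S z" unfolding eq' by (rule sums_summable[OF *, THEN summable_sums])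
  show "S z = z * (\<Sum>n. of_real (c n (2 * n + 1)) * (z\<^sup>2) ^ n)"
    unfolding eq' by (rule sums_unique[OF *, symmetric])
qed

lemma S_holo: "S holomorphic_on A"
proof -
  define g where "g = (\<lambda>x::complex. \<Sum>n. of_real (c n (2 * n + 1)) * x ^ n)"
  have "g holomorphic_on UNIV" unfolding g_def by (rule coeff_powser(2))
  then have "(\<lambda>z. z * (g \<circ> (\<lambda>z. z\<^sup>2)) z) holomorphic_on A"
    by (intro holomorphic_intros holomorphic_on_compose_gen[where t=UNIV]) auto
  then show ?thesis by (simp add: S_eq g_def comp_def cong: holomorphic_cong)
qed

lemma C_holo: "C holomorphic_on A"
proof -
  define g where "g = (\<lambda>x::complex. \<Sum>n. of_real (c n (2 * n)) * x ^ n)"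
  have "g holomorphic_on UNIV" unfolding g_def by (rule coeff_powser(2))
  then have "(g \<circ> (\<lambda>z. z\<^sup>2)) holomorphic_on A"
    by (intro holomorphic_intros holomorphic_on_compose_gen[where t=UNIV]) auto
  then show ?thesis by (simp add: C_def g_def comp_def cong: holomorphic_cong)
qed

lemma S_scale_holo: "(\<lambda>z. S (a * z)) holomorphic_on A"
  and C_scale_holo: "(\<lambda>z. C (a * z)) holomorphic_on A"
proof -
  have m: "(\<lambda>z. a * z) holomorphic_on A" by (intro holomorphic_intros)
  show "(\<lambda>z. S (a * z)) holomorphic_on A" "(\<lambda>z. C (a * z)) holomorphic_on A"
    using holomorphic_on_compose[OF m S_holo] holomorphic_on_compose[OF m C_holo] by (simp_all add: comp_def)
qed

lemma S_has_deriv: "(S has_field_derivative deriv S z) (at z)"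
  and C_has_deriv: "(C has_field_derivative deriv C z) (at z)"
  using holomorphic_derivI[OF S_holo open_UNIV] holomorphic_derivI[OF C_holo open_UNIV] by auto

lemma S_cont: "continuous_on A S" and C_cont: "continuous_on A C"
  by (intro holomorphic_on_imp_continuous_on S_holo C_holo)+

lemma S_0 [simp]: "S 0 = 0" by (simp add: S_eq)

lemma C_0 [simp]: "C 0 = 1"
proof -
  have "C 0 = of_real (c 0 (2 * 0))"
    unfolding C_def using powser_zero[of "\<lambda>n. of_real (c n (2 * n)) :: complex"] by simp
  then show ?thesis by (simp add: qpoch_def c_def)
qed

lemma S_uminus: "S (- z) = - S z" by (simp add: S_eq)

lemma S_cnj: "S (cnj z) = cnj (S z)"
proof -
  have "(\<lambda>n. cnj (of_real (c n (2 * n + 1)) * z ^ (2 * n + 1))) sums cnj (S z)"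
    using S_sums by (subst sums_cnj)
  then show ?thesis
    using S_sums[of "cnj z"] by (simp add: sums_unique2)
qed

lemma C_cnj: "C (cnj z) = cnj (C z)"
proof -
  have "(\<lambda>n. cnj (of_real (c n (2 * n)) * z ^ (2 * n))) sums cnj (C z)"
    using C_sums by (subst sums_cnj)
  then show ?thesis
    using C_sums[of "cnj z"] by (simp add: sums_unique2)
qed

lemma c_odd: "c n (2 * n + 1) * (1 - q ^ (2 * n + 1)) = c n (2 * n)"
  using qpoch_nz[of "Suc (2 * n)"] by (simp add: c_def qpoch_Suc del: qpoch_nz power_Suc)

lemma c_even: "c (Suc n) (2 * Suc n) * (1 - q ^ (2 * Suc n)) = - (q ^ (2 * n + 2) * c n (2 * n + 1))"
proof -
  define t where "t = 1 - q ^ (2 * Suc n)"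
  have p: "qpoch q q (2 * Suc n) = qpoch q q (2 * n + 1) * t"
    using qpoch_Suc[of "2 * n + 1"] by (simp add: t_def)
  have t: "t \<noteq> 0"
    using p qpoch_nz[of "2 * Suc n"] by auto
  have e: "q ^ (Suc n * (Suc n + 1)) = q ^ (2 * n + 2) * q ^ (n * (n + 1))"
    unfolding power_add[symmetric] by (rule arg_cong[of _ _ "power q"]) (simp add: algebra_simps)
  have "c (Suc n) (2 * Suc n) * t = - ((-1) ^ n * (q ^ (2 * n + 2) * q ^ (n * (n + 1))) / qpoch q q (2 * n + 1))"
    unfolding c_def p e power_Suc using t by (simp only: field_simps) simp
  then show ?thesis unfolding c_def t_def by (simp only: mult_ac times_divide_eq_right)
qed

text \<open>Passing from \<open>z\<close> to \<open>q * z\<close> multiplies the \<open>n\<close>-th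
  term by \<open>q ^ (2 * n + 1)\<close>, and the factor \<open>1 - q ^ (2 * n + 1)\<close> cancels
  the last factor of \<open>(q; q)\<^sub>2\<^sub>n\<^sub>+\<^sub>1\<close>. Together with
  \<open>C_diff\<close> this plays the role of the derivative rules for sine and cosine.\<close>
lemma S_diff: "S z - S (of_real q * z) = z * C z"
proof -
  have "(\<lambda>n. of_real (c n (2 * n + 1)) * z ^ (2 * n + 1)
      - of_real (c n (2 * n + 1)) * (of_real q * z) ^ (2 * n + 1)) sums (S z - S (of_real q * z))"
    by (intro sums_diff S_sums)
  moreover have "of_real (c n (2 * n + 1)) * z ^ (2 * n + 1)
      - of_real (c n (2 * n + 1)) * (of_real q * z) ^ (2 * n + 1)
    = z * (of_real (c n (2 * n)) * z ^ (2 * n))" for n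
    unfolding c_odd[symmetric] by (simp add: power_mult_distrib algebra_simps)
  ultimately show ?thesis
    using sums_mult[OF C_sums[of z], of z] by (simp add: sums_unique2)
qed

lemma C_diff: "C z - C (of_real q * z) = - (of_real q * z * S (of_real q * z))"
proof -
  let ?w = "of_real q * z"
  have "(\<lambda>n. of_real (c n (2 * n)) * z ^ (2 * n) - of_real (c n (2 * n)) * ?w ^ (2 * n))
      sums (C z - C ?w)"
    by (intro sums_diff C_sums)
  moreover have "of_real (c n (2 * n)) * z ^ (2 * n) - of_real (c n (2 * n)) * ?w ^ (2 * n)
      = of_real (c n (2 * n) * (1 - q ^ (2 * n))) * z ^ (2 * n)" for n
    by (simp add: power_mult_distrib algebra_simps)
  ultimately have "(\<lambda>n. of_real (c n (2 * n) * (1 - q ^ (2 * n))) * z ^ (2 * n)) sums (C z - C ?w)"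
    by simp
  then have "(\<lambda>n. of_real (c (Suc n) (2 * Suc n) * (1 - q ^ (2 * Suc n))) * z ^ (2 * Suc n))
      sums (C z - C ?w)"
    by (subst sums_Suc_iff) simp
  moreover have "of_real (c (Suc n) (2 * Suc n) * (1 - q ^ (2 * Suc n))) * z ^ (2 * Suc n)
     = - ?w * (of_real (c n (2 * n + 1)) * ?w ^ (2 * n + 1))" for n
    unfolding c_even by (simp add: power_mult_distrib algebra_simps power_add)
  ultimately have "(\<lambda>n. - ?w * (of_real (c n (2 * n + 1)) * ?w ^ (2 * n + 1))) sums (C z - C ?w)"
    by simp
  moreover have "(\<lambda>n. - ?w * (of_real (c n (2 * n + 1)) * ?w ^ (2 * n + 1))) sums (- ?w * S ?w)"
    by (intro sums_mult S_sums)
  ultimately show ?thesis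
    using sums_unique2 by fastforce
qed

section \<open>Reality and simplicity of the zeros\<close>

lemma power_q_mult_tendsto_0: "(\<lambda>n. of_real q ^ n * z :: complex) \<longlonglongrightarrow> 0"
  using q_pos q_less_1 by (intro tendsto_mult_left_zero LIMSEQ_power_zero) auto

text \<open>Up to a factor \<open>q powr (1/2)\<close>, the boundary term at index \<open>-1\<close>
  of the Christoffel--Darboux summation for the Jacobi recurrence at two arguments; the later
  boundary terms have the same form at \<open>q ^ N * z\<close> and
  \<open>q ^ N * y\<close>.\<close>
definition casorati :: "complex \<Rightarrow> complex \<Rightarrow> complex" where
  "casorati z y = C z * S y - S z * C y"

text \<open>A partial sum of \<open>\<Sum>n. \<Psi>\<^sub>n(z) \<Psi>\<^sub>n(y)\<close>, where
  \<open>\<Psi>\<close> is the solution \<open>Psi\<close> of the recurrence defined further below;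
  the indices are grouped in pairs \<open>2 * k\<close>, \<open>2 * k + 1\<close>.\<close>
definition gram :: "nat \<Rightarrow> complex \<Rightarrow> complex \<Rightarrow> complex" where
  "gram N z y = (\<Sum>k<N. of_real q ^ k * (C (of_real q ^ k * z) * C (of_real q ^ k * y)
      + of_real q * S (of_real q ^ Suc k * z) * S (of_real q ^ Suc k * y)))"

lemma gram_Suc: "gram (Suc N) z y = gram N z y + of_real q ^ N * (C (of_real q ^ N * z) * C (of_real q ^ N * y)
      + of_real q * S (of_real q ^ Suc N * z) * S (of_real q ^ Suc N * y))"
  by (simp add: gram_def)

text \<open>One Christoffel--Darboux step over a pair of indices: both difference equations combine
  so that only products of equal functions survive.\<close>
lemma casorati_step:
  "casorati (of_real q * z) (of_real q * y)
    = casorati z y + (z - y) * (C z * C y + of_real q * S (of_real q * z) * S (of_real q * y))"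
proof -
  have "S z = S (of_real q * z) + z * C z" "S y = S (of_real q * y) + y * C y"
    using S_diff[of z] S_diff[of y] by (simp_all add: algebra_simps)
  moreover have "C (of_real q * z) = C z + of_real q * z * S (of_real q * z)"
      "C (of_real q * y) = C y + of_real q * y * S (of_real q * y)"
    using C_diff[of z] C_diff[of y] by (simp_all add: algebra_simps)
  ultimately show ?thesis unfolding casorati_def by (simp only:) (simp add: algebra_simps)
qed

lemma casorati_iterate: "casorati (of_real q ^ N * z) (of_real q ^ N * y) = casorati z y + (z - y) * gram N z y"
proof (induction N)
  case (Suc N)
  have "casorati (of_real q ^ Suc N * z) (of_real q ^ Suc N * y)
     = casorati (of_real q * (of_real q ^ N * z)) (of_real q * (of_real q ^ N * y))"
    by (simp add: mult.assoc)
  also have "\<dots> = casorati z y + (z - y) * gram (Suc N) z y"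
    unfolding casorati_step Suc gram_Suc by (simp add: algebra_simps)
  finally show ?case .
qed (simp add: gram_def)

text \<open>By the difference equations a common zero \<open>z\<close> would propagate to all
  \<open>q ^ N * z\<close>, contradicting \<open>C 0 = 1\<close> by continuity.\<close>
lemma S_C_no_common_zero:
  assumes "S z = 0" shows "C z \<noteq> 0"
proof
  assume "C z = 0"
  have *: "S (of_real q ^ N * z) = 0 \<and> C (of_real q ^ N * z) = 0" for N
  proof (induction N)
    case (Suc N)
    then show ?case
      using S_diff[of "of_real q ^ N * z"] C_diff[of "of_real q ^ N * z"] by (simp add: mult.assoc)
  qed (use assms \<open>C z = 0\<close> in simp)
  have "isCont C 0" using C_cont[of UNIV] by (simp add: continuous_on_eq_continuous_at)
  then have "(\<lambda>N. C (of_real q ^ N * z)) \<longlonglongrightarrow> C 0"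
    using power_q_mult_tendsto_0 by (rule isCont_tendsto_compose)
  then show False using * by (simp add: LIMSEQ_const_iff)
qed

text \<open>At conjugate arguments every summand is a nonnegative real, and the first one is already
  at least \<open>(cmod (C z))\<^sup>2\<close>.\<close>
lemma gram_cnj: "0 < N \<Longrightarrow> (cmod (C z))\<^sup>2 \<le> Re (gram N z (cnj z))" "Im (gram N z (cnj z)) = 0"
proof -
  have eq: "gram N z (cnj z) = of_real (\<Sum>k<N. q ^ k * ((cmod (C (of_real q ^ k * z)))\<^sup>2
      + q * (cmod (S (of_real q ^ Suc k * z)))\<^sup>2))"
  proof -
    have "of_real q ^ k * cnj z = cnj (of_real q ^ k * z)" for k by simp
    moreover have "x * cnj x = of_real ((cmod x)\<^sup>2)" for x
      by (metis complex_norm_square)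
    ultimately show ?thesis
      unfolding gram_def by (simp only: S_cnj C_cnj mult.assoc) simp
  qed
  then show "Im (gram N z (cnj z)) = 0" by simp
  show "(cmod (C z))\<^sup>2 \<le> Re (gram N z (cnj z))" if "0 < N"
  proof -
    have "q ^ 0 * ((cmod (C (of_real q ^ 0 * z)))\<^sup>2 + q * (cmod (S (of_real q ^ Suc 0 * z)))\<^sup>2)
      \<le> (\<Sum>k<N. q ^ k * ((cmod (C (of_real q ^ k * z)))\<^sup>2
      + q * (cmod (S (of_real q ^ Suc k * z)))\<^sup>2))"
      using that q_pos by (intro member_le_sum) auto
    moreover have "0 \<le> q * (cmod (S (of_real q * z)))\<^sup>2" using q_pos by simp
    ultimately show ?thesis unfolding eq by (simp add: Re_complex_of_real)
  qed
qed

text \<open>This is the reality of the eigenvalues of a symmetric operator. At a zero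
  \<open>z\<close> the boundary term between \<open>z\<close> and \<open>cnj z\<close> vanishes at
  the start of the recurrence, and it tends to 0 at the far end. Hence
  \<open>(z - cnj z) * gram N z (cnj z)\<close> tends to 0, although the second factor stays away
  from 0.\<close>
lemma zeros_real: assumes "S z = 0" shows "z \<in> \<real>"
proof (rule ccontr)
  assume "z \<notin> \<real>"
  then have nz: "z - cnj z \<noteq> 0" by (metis Reals_cnj_iff eq_iff_diff_eq_0)
  have "isCont C 0" "isCont S 0"
    using C_cont[of UNIV] S_cont[of UNIV] by (simp_all add: continuous_on_eq_continuous_at)
  then have "(\<lambda>N. casorati (of_real q ^ N * z) (of_real q ^ N * cnj z)) \<longlonglongrightarrow> C 0 * S 0 - S 0 * C 0"
    unfolding casorati_def
    by (intro tendsto_intros isCont_tendsto_compose[of _ C] isCont_tendsto_compose[of _ S] power_q_mult_tendsto_0) auto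
  then have "(\<lambda>N. (z - cnj z) * gram N z (cnj z)) \<longlonglongrightarrow> 0"
    unfolding casorati_iterate using assms by (simp add: casorati_def S_cnj)
  then have "(\<lambda>N. gram N z (cnj z)) \<longlonglongrightarrow> 0"
    using tendsto_mult_left_iff[OF nz, of "\<lambda>N. gram N z (cnj z)" 0] by (simp only: mult_zero_right)
  then have "(\<lambda>N. Re (gram N z (cnj z))) \<longlonglongrightarrow> 0"
    using tendsto_Re by fastforce
  then have "(cmod (C z))\<^sup>2 \<le> 0"
    by (rule LIMSEQ_le_const) (intro exI[of _ 1] allI impI gram_cnj(1), simp)
  then show False using S_C_no_common_zero[OF assms] by simp
qed

text \<open>The confluent form of Christoffel--Darboux: differentiating
  \<open>casorati_iterate\<close> in \<open>y\<close> at \<open>y = z\<close> leaves the Wronskian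
  as the limit of the sums \<open>gram N z z\<close>, because the chain rule multiplies the far
  boundary term by \<open>q ^ N\<close>.\<close>
lemma wronskian_lower_bound:
  assumes "z \<in> \<real>"
  shows "Im (C z * deriv S z - S z * deriv C z) = 0"
    and "(cmod (C z))\<^sup>2 \<le> Re (C z * deriv S z - S z * deriv C z)"
proof -
  define W where "W = (\<lambda>y. C y * deriv S y - S y * deriv C y)"
  have cz: "cnj z = z" using assms by (simp add: Reals_cnj_iff)
  have dcas: "((\<lambda>y. casorati w y) has_field_derivative (C w * deriv S y - S w * deriv C y)) (at y)" for w y
    unfolding casorati_def by (auto intro!: derivative_eq_intros S_has_deriv C_has_deriv)
  have key: "of_real q ^ N * W (of_real q ^ N * z) = W z - gram N z z" for N
  proof -
    have "((\<lambda>y. casorati (of_real q ^ N * z) (of_real q ^ N * y)) has_field_derivative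
        W (of_real q ^ N * z) * of_real q ^ N) (at z)"
      by (rule DERIV_chain2[where f = "\<lambda>y. casorati (of_real q ^ N * z) y"])
         (use dcas in \<open>auto simp: W_def intro!: derivative_eq_intros\<close>)
    moreover have "(\<lambda>y. gram N z y) holomorphic_on UNIV"
      unfolding gram_def by (intro holomorphic_intros C_scale_holo S_scale_holo)
    then have "((\<lambda>y. gram N z y) has_field_derivative deriv (gram N z) z) (at z)"
      using holomorphic_derivI[OF _ open_UNIV] by auto
    then have "((\<lambda>y. casorati z y + (z - y) * gram N z y) has_field_derivative W z - gram N z z) (at z)"
      by (auto intro!: derivative_eq_intros dcas simp: W_def)
    ultimately show ?thesis
      unfolding casorati_iterate using DERIV_unique by (metis mult.commute)
  qed
  have "isCont W 0"
  proof -
    have "W holomorphic_on UNIV"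
      unfolding W_def by (intro holomorphic_intros S_holo C_holo) auto
    then show ?thesis
      using holomorphic_on_imp_continuous_on continuous_on_eq_continuous_at by blast
  qed
  then have "(\<lambda>N. W (of_real q ^ N * z)) \<longlonglongrightarrow> W 0"
    using power_q_mult_tendsto_0 by (rule isCont_tendsto_compose)
  moreover have "(\<lambda>N. complex_of_real q ^ N) \<longlonglongrightarrow> 0"
    using q_pos q_less_1 by (intro LIMSEQ_power_zero) auto
  ultimately have "(\<lambda>N. W z - gram N z z) \<longlonglongrightarrow> 0 * W 0"
    unfolding key[symmetric] by (intro tendsto_mult)
  then have lim: "(\<lambda>N. gram N z z) \<longlonglongrightarrow> W z"
    using tendsto_diff[of "\<lambda>N. W z" "W z" sequentially "\<lambda>N. W z - gram N z z" 0] by simp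
  show "Im (C z * deriv S z - S z * deriv C z) = 0"
    using tendsto_Im[OF lim] gram_cnj(2)[of _ z] unfolding cz W_def by (simp add: LIMSEQ_const_iff)
  show "(cmod (C z))\<^sup>2 \<le> Re (C z * deriv S z - S z * deriv C z)"
    using tendsto_Re[OF lim] unfolding W_def
    by (rule LIMSEQ_le_const) (intro exI[of _ 1] allI impI gram_cnj(1)[of _ z, unfolded cz], simp)
qed

text \<open>By the difference equation, \<open>mass z\<close> is
  \<open>- S (q * z) / (z * deriv S z)\<close> at a nonzero zero, so these are the weights of the
  orthogonality relation. The present form also makes sense at the zero \<open>0\<close>.\<close>
definition mass :: "complex \<Rightarrow> complex" where "mass z = C z / deriv S z"

text \<open>At a zero the Wronskian is \<open>C z * deriv S z\<close>, which is therefore positive;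
  the mass is the square of the real number \<open>C z\<close> divided by it.\<close>
lemma simple_zero_mass_pos:
  assumes "S z = 0"
  shows "deriv S z \<noteq> 0" and "\<exists>r>0. mass z = of_real r"
proof -
  note w = wronskian_lower_bound[OF zeros_real[OF assms], unfolded assms mult_zero_left diff_zero]
  define p where "p = Re (C z * deriv S z)"
  have p: "C z * deriv S z = of_real p" using w(1) by (simp add: complex_eq_iff p_def)
  have "0 < p" using w(2) S_C_no_common_zero[OF assms] unfolding p_def
    by (smt (verit) zero_less_norm_iff zero_less_power)
  then show nz: "deriv S z \<noteq> 0" using p by auto
  have "cnj (C z) = C z" using zeros_real[OF assms] C_cnj by (metis Reals_cnj_iff)
  then have "C z = of_real (Re (C z))" by (simp add: complex_eq_iff)
  moreover have "C z \<noteq> 0" using S_C_no_common_zero[OF assms] .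
  ultimately obtain d where d: "C z = of_real d" "d \<noteq> 0" by fastforce
  have "mass z = (C z)\<^sup>2 / (C z * deriv S z)"
    using nz d unfolding mass_def by (simp add: power2_eq_square)
  also have "\<dots> = of_real (d\<^sup>2 / p)" unfolding p by (simp add: d)
  finally show "\<exists>r>0. mass z = of_real r" using \<open>0 < p\<close> d(2) by (intro exI[of _ "d\<^sup>2/p"]) simp
qed

section \<open>Growth of the q-sine on circles that avoid its zeros\<close>

text \<open>The sum over \<open>j\<close> in \<open>\<int>\<close> of
  \<open>(-1) ^ j * q ^ (j * (j + 1)) * \<zeta> ^ (2 * j)\<close> is split at \<open>j = 0\<close>.
  Replacing \<open>j\<close> by \<open>-1 - i\<close> shows that its negative half is
  \<open>- 1 / \<zeta>\<^sup>2\<close> times the same power series in the variable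
  \<open>1 / \<zeta>\<^sup>2\<close>.\<close>
definition half_theta :: "complex \<Rightarrow> complex" where
  "half_theta x = (\<Sum>j. of_real ((-1) ^ j * q ^ (j * (j + 1))) * x ^ j)"

definition theta :: "complex \<Rightarrow> complex" where
  "theta \<zeta> = half_theta (\<zeta>\<^sup>2) - half_theta (inverse \<zeta> ^ 2) * inverse \<zeta> ^ 2"

lemma theta_coeff_bound: "norm (of_real ((-1) ^ n * q ^ (n * (n + 1))) :: complex) \<le> 1 * q ^ (n * (n + 1))"
  using q_pos by (simp add: norm_mult norm_power)

lemmas theta_powser = theta_dominated_powser[OF q_pos q_less_1 theta_coeff_bound]

lemma theta_holo: "theta holomorphic_on - {0}"
proof -
  have h: "half_theta holomorphic_on UNIV"
    unfolding half_theta_def by (rule theta_powser(2))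
  have "(half_theta \<circ> (\<lambda>z. z\<^sup>2)) holomorphic_on - {0}"
       "(half_theta \<circ> (\<lambda>z. inverse z ^ 2)) holomorphic_on - {0}"
    by (rule holomorphic_on_compose_gen[OF _ h]; auto intro!: holomorphic_intros)+
  then show ?thesis
    unfolding theta_def by (auto intro!: holomorphic_intros simp: comp_def)
qed

text \<open>At \<open>\<i>\<close> all signs cancel and the series has positive terms, so theta is
  not identically zero.\<close>
lemma theta_ii: "theta \<i> \<noteq> 0"
proof -
  have eq: "(-1) ^ j * q ^ (j * (j + 1)) * (-1) ^ j = q ^ (j * (j + 1))" for j :: nat
    by (simp add: mult.commute mult.left_commute flip: power_mult_distrib)
  have "half_theta (-1) = (\<Sum>j. of_real ((-1) ^ j * q ^ (j * (j + 1)) * (-1) ^ j))"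
    unfolding half_theta_def by simp
  also have "\<dots> = (\<Sum>j. of_real (q ^ (j * (j + 1))))"
    unfolding eq ..
  also have "\<dots> = of_real (\<Sum>j. q ^ (j * (j + 1)))"
    using summable_theta_powers[OF q_pos q_less_1, of 1] by (subst suminf_of_real) simp_all
  finally have h: "half_theta (-1) = of_real (\<Sum>j. q ^ (j * (j + 1)))" .
  have "0 < (\<Sum>j. q ^ (j * (j + 1)))"
    using summable_theta_powers[OF q_pos q_less_1, of 1] q_pos by (intro suminf_pos) simp_all
  moreover have "theta \<i> = 2 * half_theta (-1)"
    by (simp add: theta_def)
  ultimately show ?thesis unfolding h by (metis less_irrefl mult_eq_0_iff of_real_eq_0_iff zero_neq_numeral)
qed

text \<open>An analytic function that is not identically zero has finitely many zeros in the annulus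
  \<open>1 \<le> norm \<zeta> \<le> 2\<close>, whereas there are infinitely many circles in
  it.\<close>
lemma zero_free_circle:
  obtains \<rho> where "0 < \<rho>" "\<And>\<zeta>. norm \<zeta> = \<rho> \<Longrightarrow> theta \<zeta> \<noteq> 0"
proof -
  let ?K = "cball 0 2 - ball 0 1 :: complex set"
  have "compact ?K" by (intro compact_diff) auto
  have fin: "finite {z \<in> ?K. theta z = 0}"
  proof (cases "theta constant_on - {0}")
    case True
    then obtain y where y: "theta z = y" if "z \<noteq> 0" for z
      unfolding constant_on_def by auto
    have "theta z \<noteq> 0" if "z \<in> ?K" for z
    proof -
      have z: "z \<noteq> 0" using that by auto
      show ?thesis using theta_ii unfolding y[OF z] y[OF complex_i_not_zero] .
    qed
    then have "{z \<in> ?K. theta z = 0} = {}" by blast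
    then show ?thesis by (simp only: finite.emptyI)
  next
    case False
    then show ?thesis
      using \<open>compact ?K\<close> connected_punctured_universe[of "0 :: complex"]
      by (intro holomorphic_compact_finite_zeros[OF theta_holo]) auto
  qed
  have "infinite {1..2::real}" by (simp add: infinite_Icc_iff)
  then have "\<not> {1..2} \<subseteq> norm ` {z \<in> ?K. theta z = 0}"
    using finite_subset[OF _ finite_imageI[OF fin, of norm]] by blast
  then obtain \<rho> where \<rho>: "\<rho> \<in> {1..2}" "\<rho> \<notin> norm ` {z \<in> ?K. theta z = 0}"
    by blast
  show thesis
  proof (rule that)
    show "0 < \<rho>" using \<rho> by simp
    show "theta \<zeta> \<noteq> 0" if "norm \<zeta> = \<rho>" for \<zeta>
    proof
      assume "theta \<zeta> = 0"
      moreover have "\<zeta> \<in> ?K" using \<rho>(1) that by simp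
      ultimately have "norm \<zeta> \<in> norm ` {z \<in> ?K. theta z = 0}" by blast
      then show False using \<rho>(2) that by simp
    qed
  qed
qed

definition weighted :: "(nat \<Rightarrow> real) \<Rightarrow> complex \<Rightarrow> complex" where
  "weighted w x = (\<Sum>j. of_real (w j) * of_real ((-1) ^ j * q ^ (j * (j + 1))) * x ^ j)"

text \<open>Dominated convergence, with the error bounded by a series that depends on
  \<open>x\<close> only through \<open>r\<close>; the limit is thus uniform on the disc.\<close>
lemma weighted_half_theta_approx:
  fixes w :: "nat \<Rightarrow> nat \<Rightarrow> real" and r :: real
  assumes bd: "\<And>N j. \<bar>w N j\<bar> \<le> M" and lim: "\<And>j. (\<lambda>N. w N j) \<longlonglongrightarrow> L" and r: "0 \<le> r"
  obtains \<delta> where "\<delta> \<longlonglongrightarrow> 0"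
    "\<And>N x. norm x \<le> r \<Longrightarrow>
       norm (weighted (w N) x - of_real L * half_theta x) \<le> \<delta> N"
proof -
  define t where "t = (\<lambda>j N. \<bar>w N j - L\<bar> * (q ^ (j * (j + 1)) * r ^ j))"
  have base: "summable (\<lambda>j. q ^ (j * (j + 1)) * r ^ j)"
    by (rule summable_theta_powers[OF q_pos q_less_1 r])
  have bt: "norm (t j N) \<le> (M + \<bar>L\<bar>) * (q ^ (j * (j + 1)) * r ^ j)" for j N
  proof -
    have "\<bar>w N j - L\<bar> \<le> M + \<bar>L\<bar>" using bd[of N j] by linarith
    then show ?thesis unfolding t_def using q_pos r
      by (auto simp: abs_mult intro!: mult_right_mono)
  qed
  have st: "summable (\<lambda>j. t j N)" for N
    by (rule summable_comparison_test'[OF summable_mult[OF base] bt])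
  have "(\<lambda>N. \<Sum>j. t j N) \<longlonglongrightarrow> (\<Sum>j. 0)"
  proof (rule tannerys_theorem[THEN conjunct2, THEN conjunct2])
    show "(\<lambda>N. t j N) \<longlonglongrightarrow> 0" for j
      unfolding t_def
      by (intro tendsto_mult_left_zero tendsto_rabs_zero) (use lim in \<open>simp add: LIM_zero_iff\<close>)
    show "summable (\<lambda>j. (M + \<bar>L\<bar>) * (q ^ (j * (j + 1)) * r ^ j))"
      by (rule summable_mult[OF base])
  qed (use bt in \<open>auto intro: always_eventually\<close>)
  then have d0: "(\<lambda>N. \<Sum>j. t j N) \<longlonglongrightarrow> 0" by simp
  show thesis
  proof (rule that[OF d0])
    fix N :: nat and x :: complex
    assume x: "norm x \<le> r"
    let ?g = "\<lambda>j. of_real ((-1) ^ j * q ^ (j * (j + 1))) * x ^ j :: complex"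
    have nt: "norm (of_real (w N j - L) * ?g j) \<le> t j N" for j
    proof -
      have "norm (of_real (w N j - L) * ?g j) = \<bar>w N j - L\<bar> * (q ^ (j * (j + 1)) * norm x ^ j)"
        unfolding norm_mult norm_of_real norm_power using q_pos by (simp add: abs_mult power_abs)
      also have "\<dots> \<le> t j N"
        unfolding t_def using q_pos x by (intro mult_left_mono power_mono) auto
      finally show ?thesis .
    qed
    have s1: "summable (\<lambda>j. of_real (w N j - L) * ?g j)"
      by (rule summable_comparison_test'[OF st nt])
    have s2: "summable ?g" by (rule theta_powser(1))
    have "(\<lambda>j. of_real (w N j - L) * ?g j + of_real L * ?g j) sums
        ((\<Sum>j. of_real (w N j - L) * ?g j) + of_real L * half_theta x)"
      unfolding half_theta_def using s1 s2 by (intro sums_add sums_mult summable_sums)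
    moreover have "of_real (w N j - L) * ?g j + of_real L * ?g j
        = of_real (w N j) * of_real ((-1) ^ j * q ^ (j * (j + 1))) * x ^ j" for j
      by (simp add: algebra_simps)
    ultimately have "weighted (w N) x - of_real L * half_theta x = (\<Sum>j. of_real (w N j - L) * ?g j)"
      by (simp add: weighted_def sums_unique[symmetric])
    also have "norm \<dots> \<le> (\<Sum>j. t j N)"
      using nt st by (rule norm_suminf_le)
    finally show "norm (weighted (w N) x - of_real L * half_theta x) \<le> (\<Sum>j. t j N)" .
  qed
qed

definition upper_weight :: "nat \<Rightarrow> nat \<Rightarrow> real" where
  "upper_weight N j = 1 / qpoch q q (2 * (j + N) + 1)"

text \<open>The value 0 for \<open>i \<ge> N\<close> encodes that the power series of the sine has
  no terms of negative index.\<close>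
definition lower_weight :: "nat \<Rightarrow> nat \<Rightarrow> real" where
  "lower_weight N i = (if i < N then 1 / qpoch q q (2 * (N - 1 - i) + 1) else 0)"

lemma inverse_qpoch_bound: "\<bar>1 / qpoch q q m\<bar> \<le> 1 / qinf"
  using qinf_le_qpoch[of m] qinf_pos by (simp add: frac_le)

lemma weights_bound: "\<bar>upper_weight N j\<bar> \<le> 1 / qinf" "\<bar>lower_weight N j\<bar> \<le> 1 / qinf"
  unfolding upper_weight_def lower_weight_def using inverse_qpoch_bound qinf_pos by auto

lemma inverse_qpoch_tendsto:
  assumes "filterlim f at_top sequentially"
  shows "(\<lambda>N. 1 / qpoch q q (f N)) \<longlonglongrightarrow> 1 / qinf"
proof -
  have "(\<lambda>n. 1 / qpoch q q n) \<longlonglongrightarrow> 1 / qinf"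
    using qpoch_tendsto qinf_pos by (intro tendsto_intros) auto
  then show ?thesis using assms by (rule filterlim_compose)
qed

lemma upper_weight_tendsto: "(\<lambda>N. upper_weight N j) \<longlonglongrightarrow> 1 / qinf"
  unfolding upper_weight_def
  by (rule inverse_qpoch_tendsto, rule filterlim_at_top_mono[OF filterlim_ident]) auto

lemma lower_weight_tendsto: "(\<lambda>N. lower_weight N j) \<longlonglongrightarrow> 1 / qinf"
proof -
  have "filterlim (\<lambda>N. N - j) at_top sequentially"
    by (rule filterlim_minus_const_nat_at_top)
  then have "filterlim (\<lambda>N. 2 * (N - 1 - j) + 1) at_top sequentially"
    by (rule filterlim_at_top_mono) (rule eventually_sequentiallyI[of "j+1"], simp)
  then have "(\<lambda>N. 1 / qpoch q q (2 * (N - 1 - j) + 1)) \<longlonglongrightarrow> 1 / qinf"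
    by (rule inverse_qpoch_tendsto)
  moreover have "eventually (\<lambda>N. 1 / qpoch q q (2 * (N - 1 - j) + 1) = lower_weight N j) sequentially"
    by (rule eventually_sequentiallyI[of "j+1"]) (simp add: lower_weight_def)
  ultimately show ?thesis by (rule Lim_transform_eventually)
qed

text \<open>Completing the square: at \<open>\<zeta> / q ^ N\<close> the terms of the series peak
  near \<open>n = N\<close>. Writing \<open>n = N + j\<close> or \<open>n = N - 1 - i\<close> turns
  the exponent \<open>n * (n + 1) + N\<^sup>2 - N * (2 * n + 1)\<close> into
  \<open>j * (j + 1)\<close> or \<open>i * (i + 1)\<close>. What remains is a theta series whose
  weights tend to a constant.\<close>
lemma S_rescaled:
  assumes "\<zeta> \<noteq> 0"
  shows "of_real (q ^ N\<^sup>2) * S (\<zeta> / of_real q ^ N) = (-1) ^ N * \<zeta> ^ (2 * N + 1) *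
     (weighted (upper_weight N) (\<zeta>\<^sup>2) - weighted (lower_weight N) (inverse \<zeta> ^ 2) * inverse \<zeta> ^ 2)"
proof -
  define f where "f = (\<lambda>n. of_real (q ^ N\<^sup>2) * (of_real (c n (2 * n + 1)) * (\<zeta> / of_real q ^ N) ^ (2 * n + 1)))"
  have q0: "complex_of_real q \<noteq> 0" using q_pos by simp
  have sf: "f sums (of_real (q ^ N\<^sup>2) * S (\<zeta> / of_real q ^ N))"
    unfolding f_def by (intro sums_mult S_sums)
  let ?g = "\<lambda>w x j. of_real (w j) * of_real ((-1) ^ j * q ^ (j * (j + 1))) * x ^ j :: complex"
  have alg0: "a * (s * b / p * (z / d)) = (a * b) * (s / p * (z / d))"
    and alg1: "a * ((s * t) / p * (z * x)) = t * z * (1 / p * (s * a) * x)"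
    and alg2: "a * ((- (t * s)) / p * (z * x ^ Suc i)) = - (t * z * (1 / p * (s * a) * x ^ i * x))"
    for a b s t p z x d :: complex and i
    by simp_all
  have up: "f (j + N) = (-1) ^ N * \<zeta> ^ (2 * N + 1) * ?g (upper_weight N) (\<zeta>\<^sup>2) j" for j
  proof -
    have e: "(j + N) * ((j + N) + 1) + N\<^sup>2 = N * (2 * (j + N) + 1) + j * (j + 1)"
      by (simp add: algebra_simps power2_eq_square)
    have "q ^ N\<^sup>2 * q ^ ((j + N) * ((j + N) + 1)) = q ^ (N * (2 * (j + N) + 1)) * q ^ (j * (j + 1))"
      unfolding power_add[symmetric] using e by (simp only: add.commute)
    then have e': "complex_of_real q ^ N\<^sup>2 * of_real q ^ ((j + N) * ((j + N) + 1))
        = of_real q ^ (N * (2 * (j + N) + 1)) * of_real q ^ (j * (j + 1))"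
      by (simp only: of_real_power[symmetric] of_real_mult[symmetric])
    have z: "(\<zeta> / of_real q ^ N) ^ (2 * (j + N) + 1) = \<zeta> ^ (2 * N + 1) * (\<zeta>\<^sup>2) ^ j / of_real q ^ (N * (2 * (j + N) + 1))"
      unfolding power_divide power_mult[symmetric] power_add[symmetric] by (simp add: algebra_simps)
    have "f (j + N) = (of_real q ^ N\<^sup>2 * of_real q ^ ((j + N) * ((j + N) + 1)))
        * ((-1) ^ (j + N) / of_real (qpoch q q (2 * (j + N) + 1))
        * (\<zeta> ^ (2 * N + 1) * (\<zeta>\<^sup>2) ^ j / of_real q ^ (N * (2 * (j + N) + 1))))"
      unfolding f_def c_def z of_real_mult of_real_divide of_real_power of_real_minus of_real_1
      by (rule alg0)
    also have "\<dots> = of_real q ^ (j * (j + 1)) * ((-1) ^ (j + N) / of_real (qpoch q q (2 * (j + N) + 1))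
        * (\<zeta> ^ (2 * N + 1) * (\<zeta>\<^sup>2) ^ j))"
      unfolding e' using q0 by simp
    also have "\<dots> = (-1) ^ N * \<zeta> ^ (2 * N + 1) * ?g (upper_weight N) (\<zeta>\<^sup>2) j"
      unfolding upper_weight_def power_add[of "-1 :: complex" j N] of_real_mult of_real_divide
        of_real_power of_real_minus of_real_1
      by (rule alg1)
    finally show ?thesis .
  qed
  have low: "f (N - Suc i) = - ((-1) ^ N * \<zeta> ^ (2 * N + 1) * (?g (lower_weight N) (inverse \<zeta> ^ 2) i * inverse \<zeta> ^ 2))"
    if iN: "i < N" for i
  proof -
    obtain n where n: "N = Suc (n + i)" using less_imp_Suc_add[OF iN] by (auto simp: add.commute)
    then have ni: "N - Suc i = n" "N - 1 - i = n" by simp_all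
    have e: "N\<^sup>2 + n * (n + 1) = N * (2 * n + 1) + i * (i + 1)"
      unfolding n by (simp add: algebra_simps power2_eq_square)
    have e': "complex_of_real q ^ N\<^sup>2 * of_real q ^ (n * (n + 1))
        = of_real q ^ (N * (2 * n + 1)) * of_real q ^ (i * (i + 1))"
      unfolding power_add[symmetric] e ..
    have "\<zeta> ^ (2 * N + 1) = \<zeta> ^ (2 * n + 1) * (\<zeta> ^ 2) ^ Suc i"
      unfolding n power_mult[symmetric] power_add[symmetric] by (simp add: algebra_simps)
    then have "\<zeta> ^ (2 * n + 1) = \<zeta> ^ (2 * N + 1) * (inverse \<zeta> ^ 2) ^ Suc i"
      using assms by (simp add: field_simps)
    then have z: "(\<zeta> / of_real q ^ N) ^ (2 * n + 1) = \<zeta> ^ (2 * N + 1) * (inverse \<zeta> ^ 2) ^ Suc i / of_real q ^ (N * (2 * n + 1))"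
      unfolding power_divide power_mult[symmetric] by simp
    have s: "(-1) ^ N = - ((-1) ^ n * (-1 :: complex) ^ i)"
      unfolding n by (simp add: power_add)
    have s': "(-1) ^ n = - ((-1) ^ N * (-1 :: complex) ^ i)"
      unfolding s by (simp add: mult.assoc flip: power_mult_distrib)
    have wt: "lower_weight N i = 1 / qpoch q q (2 * n + 1)"
      unfolding lower_weight_def ni(2) using iN by simp
    have "f n = (of_real q ^ N\<^sup>2 * of_real q ^ (n * (n + 1)))
        * ((-1) ^ n / of_real (qpoch q q (2 * n + 1))
        * (\<zeta> ^ (2 * N + 1) * (inverse \<zeta> ^ 2) ^ Suc i / of_real q ^ (N * (2 * n + 1))))"
      unfolding f_def c_def z of_real_mult of_real_divide of_real_power of_real_minus of_real_1
      by (rule alg0)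
    also have "\<dots> = of_real q ^ (i * (i + 1)) * ((-1) ^ n / of_real (qpoch q q (2 * n + 1))
        * (\<zeta> ^ (2 * N + 1) * (inverse \<zeta> ^ 2) ^ Suc i))"
      unfolding e' using q0 by simp
    also have "\<dots> = - ((-1) ^ N * \<zeta> ^ (2 * N + 1) * (?g (lower_weight N) (inverse \<zeta> ^ 2) i * inverse \<zeta> ^ 2))"
      unfolding wt s' of_real_mult of_real_divide of_real_power of_real_minus of_real_1
      by (rule alg2)
    finally show ?thesis unfolding ni(1) .
  qed
  have "(\<lambda>j. f (j + N)) sums (of_real (q ^ N\<^sup>2) * S (\<zeta> / of_real q ^ N) - (\<Sum>i<N. f i))"
    using sf by (simp add: sums_iff_shift)
  then have "suminf (\<lambda>j. f (j + N)) = of_real (q ^ N\<^sup>2) * S (\<zeta> / of_real q ^ N) - (\<Sum>i<N. f i)"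
    and sumf: "summable (\<lambda>j. f (j + N))"
    by (simp_all add: sums_iff)
  moreover have "suminf (\<lambda>j. f (j + N)) = (-1) ^ N * \<zeta> ^ (2 * N + 1) * weighted (upper_weight N) (\<zeta>\<^sup>2)"
  proof -
    have "summable (?g (upper_weight N) (\<zeta>\<^sup>2))"
      using sumf assms unfolding up by simp
    then show ?thesis unfolding weighted_def up by (rule suminf_mult)
  qed
  moreover have "(\<Sum>i<N. f i) = - ((-1) ^ N * \<zeta> ^ (2 * N + 1) * (weighted (lower_weight N) (inverse \<zeta> ^ 2) * inverse \<zeta> ^ 2))"
  proof -
    have "(\<Sum>i<N. f i) = (\<Sum>i<N. f (N - Suc i))"
      by (rule sum.nat_diff_reindex[symmetric])
    also have "\<dots> = (\<Sum>i<N. - ((-1) ^ N * \<zeta> ^ (2 * N + 1) * (?g (lower_weight N) (inverse \<zeta> ^ 2) i * inverse \<zeta> ^ 2)))"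
      by (intro sum.cong refl low) simp
    also have "\<dots> = - ((-1) ^ N * \<zeta> ^ (2 * N + 1) * ((\<Sum>i<N. ?g (lower_weight N) (inverse \<zeta> ^ 2) i) * inverse \<zeta> ^ 2))"
      by (simp add: sum_negf sum_distrib_left sum_distrib_right)
    also have "(\<Sum>i<N. ?g (lower_weight N) (inverse \<zeta> ^ 2) i) = weighted (lower_weight N) (inverse \<zeta> ^ 2)"
      unfolding weighted_def by (rule suminf_finite[symmetric]) (auto simp: lower_weight_def)
    finally show ?thesis .
  qed
  ultimately show ?thesis by (simp add: algebra_simps)
qed

text \<open>The circles of radius \<open>\<rho> / q ^ N\<close> are used as contours: for large
  \<open>N\<close>, \<open>S\<close> has no zeros on them and dominates its \<open>q\<close>-dilate
  there, with a gain quadratic in the radius.\<close>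
definition separating_radius :: "real \<Rightarrow> bool" where
  "separating_radius \<rho> \<longleftrightarrow> 0 < \<rho> \<and> (\<exists>K\<ge>0. \<forall>\<^sub>F N in sequentially. \<forall>w. norm w = \<rho> / q ^ N \<longrightarrow>
     S w \<noteq> 0 \<and> norm (S (of_real q * w)) \<le> K * q ^ (2 * N) * norm (S w))"

text \<open>On a circle without zeros of theta the rescaled sine converges uniformly to a function
  bounded above and bounded away from 0.\<close>
lemma S_circle_bounds:
  assumes \<rho>: "0 < \<rho>" and nz: "\<And>\<zeta>. norm \<zeta> = \<rho> \<Longrightarrow> theta \<zeta> \<noteq> 0"
  obtains l u where "0 < l" "0 < u" "\<forall>\<^sub>F N in sequentially. \<forall>\<zeta>. norm \<zeta> = \<rho> \<longrightarrow>
     l * \<rho> ^ (2 * N + 1) \<le> q ^ N\<^sup>2 * norm (S (\<zeta> / of_real q ^ N)) \<and>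
     q ^ N\<^sup>2 * norm (S (\<zeta> / of_real q ^ N)) \<le> u * \<rho> ^ (2 * N + 1)"
proof -
  define T where "T = (\<lambda>N \<zeta>. weighted (upper_weight N) (\<zeta>\<^sup>2)
      - weighted (lower_weight N) (inverse \<zeta> ^ 2) * inverse \<zeta> ^ 2)"
  have cont: "continuous_on (sphere 0 \<rho>) (\<lambda>\<zeta>. norm (theta \<zeta>))"
    using \<rho> by (intro continuous_on_norm holomorphic_on_imp_continuous_on
      holomorphic_on_subset[OF theta_holo]) auto
  have ne: "sphere (0::complex) \<rho> \<noteq> {}" "compact (sphere (0::complex) \<rho>)" using \<rho> by auto
  obtain a where a: "norm a = \<rho>" "\<And>\<zeta>. norm \<zeta> = \<rho> \<Longrightarrow> norm (theta a) \<le> norm (theta \<zeta>)"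
    using continuous_attains_inf[OF ne(2,1) cont] by auto
  obtain b where b: "norm b = \<rho>" "\<And>\<zeta>. norm \<zeta> = \<rho> \<Longrightarrow> norm (theta \<zeta>) \<le> norm (theta b)"
    using continuous_attains_sup[OF ne(2,1) cont] by auto
  \<comment> \<open>extrema on the circle of \<open>norm (theta \<zeta> / qinf)\<close>, the limit of the rescaled sine\<close>
  define m where "m = norm (theta a) / qinf"
  define M where "M = norm (theta b) / qinf"
  have m0: "0 < m" using nz[OF a(1)] qinf_pos by (simp add: m_def)
  have mM: "m \<le> M" unfolding m_def M_def using a(2)[OF b(1)] qinf_pos by (simp add: divide_right_mono)
  obtain \<delta>1 where \<delta>1: "\<delta>1 \<longlonglongrightarrow> 0" "\<And>N x. norm x \<le> \<rho>\<^sup>2 \<Longrightarrow>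
      norm (weighted (upper_weight N) x - of_real (1 / qinf) * half_theta x) \<le> \<delta>1 N"
    by (rule weighted_half_theta_approx[where w = upper_weight and r = "\<rho>\<^sup>2",
          OF weights_bound(1) upper_weight_tendsto zero_le_power2]) blast
  obtain \<delta>2 where \<delta>2: "\<delta>2 \<longlonglongrightarrow> 0" "\<And>N x. norm x \<le> inverse \<rho> ^ 2 \<Longrightarrow>
      norm (weighted (lower_weight N) x - of_real (1 / qinf) * half_theta x) \<le> \<delta>2 N"
    by (rule weighted_half_theta_approx[where w = lower_weight and r = "inverse \<rho> ^ 2",
          OF weights_bound(2) lower_weight_tendsto zero_le_power2]) blast
  define \<eta> where "\<eta> = (\<lambda>N. \<delta>1 N + \<delta>2 N * inverse \<rho> ^ 2)"
  have close: "norm (T N \<zeta> - of_real (1 / qinf) * theta \<zeta>) \<le> \<eta> N" if "norm \<zeta> = \<rho>" for N and \<zeta> :: complex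
  proof -
    have "T N \<zeta> - of_real (1 / qinf) * theta \<zeta>
      = (weighted (upper_weight N) (\<zeta>\<^sup>2) - of_real (1 / qinf) * half_theta (\<zeta>\<^sup>2))
       - (weighted (lower_weight N) (inverse \<zeta> ^ 2) - of_real (1 / qinf) * half_theta (inverse \<zeta> ^ 2)) * inverse \<zeta> ^ 2"
      unfolding T_def theta_def by (simp only: algebra_simps)
    also have "norm \<dots> \<le> norm (weighted (upper_weight N) (\<zeta>\<^sup>2) - of_real (1 / qinf) * half_theta (\<zeta>\<^sup>2))
       + norm (weighted (lower_weight N) (inverse \<zeta> ^ 2) - of_real (1 / qinf) * half_theta (inverse \<zeta> ^ 2)) * inverse \<rho> ^ 2"
      by (rule order_trans[OF norm_triangle_ineq4]) (simp add: norm_mult norm_power norm_inverse norm_divide that)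
    also have "\<dots> \<le> \<eta> N"
      unfolding \<eta>_def using that
      by (intro add_mono mult_right_mono \<delta>1 \<delta>2) (auto simp: norm_power norm_inverse)
    finally show ?thesis .
  qed
  have "\<eta> \<longlonglongrightarrow> 0 + 0 * inverse \<rho> ^ 2"
    unfolding \<eta>_def by (intro tendsto_intros \<delta>1 \<delta>2)
  then have "\<forall>\<^sub>F N in sequentially. \<eta> N < m / 2"
    by (rule order_tendstoD) (use m0 in simp)
  then have "\<forall>\<^sub>F N in sequentially. \<forall>\<zeta>. norm \<zeta> = \<rho> \<longrightarrow>
     m / 2 * \<rho> ^ (2 * N + 1) \<le> q ^ N\<^sup>2 * norm (S (\<zeta> / of_real q ^ N)) \<and>
     q ^ N\<^sup>2 * norm (S (\<zeta> / of_real q ^ N)) \<le> 2 * M * \<rho> ^ (2 * N + 1)"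
  proof (eventually_elim, intro allI impI)
    fix N and \<zeta> :: complex assume \<eta>: "\<eta> N < m / 2" and z: "norm \<zeta> = \<rho>"
    have "\<zeta> \<noteq> 0" using z \<rho> by auto
    have "q ^ N\<^sup>2 * norm (S (\<zeta> / of_real q ^ N)) = norm (of_real (q ^ N\<^sup>2) * S (\<zeta> / of_real q ^ N))"
      using q_pos by (simp add: norm_mult norm_power)
    also have "\<dots> = norm (T N \<zeta>) * \<rho> ^ (2 * N + 1)"
      unfolding S_rescaled[OF \<open>\<zeta> \<noteq> 0\<close>] T_def norm_mult norm_power z by simp
    finally have eq: "q ^ N\<^sup>2 * norm (S (\<zeta> / of_real q ^ N)) = norm (T N \<zeta>) * \<rho> ^ (2 * N + 1)" .
    have th: "m \<le> norm (of_real (1 / qinf) * theta \<zeta>)" "norm (of_real (1 / qinf) * theta \<zeta>) \<le> M"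
      using a(2)[OF z] b(2)[OF z] qinf_pos unfolding norm_mult m_def M_def
      by (simp_all add: divide_right_mono norm_divide)
    have "m / 2 \<le> norm (T N \<zeta>)" "norm (T N \<zeta>) \<le> 2 * M"
      using close[OF z, of N] \<eta> th mM m0
        norm_triangle_ineq2[of "of_real (1 / qinf) * theta \<zeta>" "T N \<zeta>"]
        norm_triangle_ineq2[of "T N \<zeta>" "of_real (1 / qinf) * theta \<zeta>"]
        norm_minus_commute[of "T N \<zeta>" "of_real (1 / qinf) * theta \<zeta>"]
      by linarith+
    then show "m / 2 * \<rho> ^ (2 * N + 1) \<le> q ^ N\<^sup>2 * norm (S (\<zeta> / of_real q ^ N)) \<and>
     q ^ N\<^sup>2 * norm (S (\<zeta> / of_real q ^ N)) \<le> 2 * M * \<rho> ^ (2 * N + 1)"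
      unfolding eq using \<rho> by (intro conjI mult_right_mono) auto
  qed
  then show thesis using m0 mM by (intro that[of "m/2" "2*M"]) auto
qed

text \<open>The bounds for \<open>N\<close> and \<open>Suc N\<close> are compared at the same point
  \<open>w\<close>; the quotient of the scaling factors \<open>q ^ N\<^sup>2\<close> gives the
  gain.\<close>
lemma separating_radius_exists: obtains \<rho> where "separating_radius \<rho>"
proof -
  obtain \<rho> where \<rho>: "0 < \<rho>" "\<And>\<zeta>. norm \<zeta> = \<rho> \<Longrightarrow> theta \<zeta> \<noteq> 0"
    using zero_free_circle by blast
  obtain l u where lu: "0 < l" "0 < u" and ev: "\<forall>\<^sub>F N in sequentially. \<forall>\<zeta>. norm \<zeta> = \<rho> \<longrightarrow>
     l * \<rho> ^ (2 * N + 1) \<le> q ^ N\<^sup>2 * norm (S (\<zeta> / of_real q ^ N)) \<and>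
     q ^ N\<^sup>2 * norm (S (\<zeta> / of_real q ^ N)) \<le> u * \<rho> ^ (2 * N + 1)" (is "\<forall>\<^sub>F N in _. ?P N")
    using S_circle_bounds[OF \<rho>] by blast
  define K where "K = u / (l * \<rho>\<^sup>2 * q)"
  have "\<forall>\<^sub>F N in sequentially. ?P N \<and> ?P (Suc N)"
    using ev ev[THEN eventually_sequentially_Suc[THEN iffD2]] by (rule eventually_conj)
  then have "\<forall>\<^sub>F N in sequentially. \<forall>w. norm w = \<rho> / q ^ Suc N \<longrightarrow>
     S w \<noteq> 0 \<and> norm (S (of_real q * w)) \<le> K * q ^ (2 * Suc N) * norm (S w)"
  proof (eventually_elim, intro allI impI)
    fix N and w :: complex
    assume P: "?P N \<and> ?P (Suc N)" and w: "norm w = \<rho> / q ^ Suc N"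
    define \<zeta> where "\<zeta> = w * of_real q ^ Suc N"
    have z: "norm \<zeta> = \<rho>" unfolding \<zeta>_def norm_mult norm_power norm_of_real w using q_pos by simp
    have w1: "\<zeta> / of_real q ^ Suc N = w" and w0: "\<zeta> / of_real q ^ N = of_real q * w"
      unfolding \<zeta>_def using q_pos by simp_all
    have lo: "l * \<rho> ^ (2 * Suc N + 1) \<le> q ^ (Suc N)\<^sup>2 * norm (S w)"
      using P z w1 by metis
    have hi: "q ^ N\<^sup>2 * norm (S (of_real q * w)) \<le> u * \<rho> ^ (2 * N + 1)"
      using P z w0 by metis
    have "0 < l * \<rho> ^ (2 * Suc N + 1)" using lu \<rho> by simp
    then have "S w \<noteq> 0" using lo by auto
    have "q ^ N\<^sup>2 * norm (S (of_real q * w)) \<le> u / (l * \<rho>\<^sup>2) * (l * \<rho> ^ (2 * Suc N + 1))"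
      using hi lu \<rho> by (simp add: power2_eq_square)
    also have "\<dots> \<le> u / (l * \<rho>\<^sup>2) * (q ^ (Suc N)\<^sup>2 * norm (S w))"
      using lo lu \<rho> by (intro mult_left_mono) auto
    also have "(Suc N)\<^sup>2 = N\<^sup>2 + (2 * N + 1)" by (simp add: power2_eq_square)
    also have "u / (l * \<rho>\<^sup>2) * (q ^ (N\<^sup>2 + (2 * N + 1)) * norm (S w))
        = q ^ N\<^sup>2 * (K * q ^ (2 * Suc N) * norm (S w))"
      unfolding K_def power_add using q_pos by (simp add: field_simps power2_eq_square)
    finally have "norm (S (of_real q * w)) \<le> K * q ^ (2 * Suc N) * norm (S w)"
      using q_pos by (simp add: mult_le_cancel_left_pos)
    with \<open>S w \<noteq> 0\<close> show "S w \<noteq> 0 \<and> norm (S (of_real q * w)) \<le> K * q ^ (2 * Suc N) * norm (S w)" ..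
  qed
  then have "\<forall>\<^sub>F N in sequentially. \<forall>w. norm w = \<rho> / q ^ N \<longrightarrow>
     S w \<noteq> 0 \<and> norm (S (of_real q * w)) \<le> K * q ^ (2 * N) * norm (S w)"
    by (rule eventually_sequentially_Suc[THEN iffD1])
  moreover have "0 \<le> K" using lu \<rho> q_pos by (simp add: K_def)
  ultimately show thesis using \<rho> by (intro that[of \<rho>]) (auto simp: separating_radius_def)
qed

lemma separating_radiusE:
  assumes "separating_radius \<rho>"
  obtains K where "0 \<le> K" "\<forall>\<^sub>F N in sequentially. \<forall>w. norm w = \<rho> / q ^ N \<longrightarrow> S w \<noteq> 0"
    "\<forall>\<^sub>F N in sequentially. \<forall>w. norm w = \<rho> / q ^ N \<longrightarrow>
       norm (S (of_real q * w)) \<le> K * q ^ (2 * N) * norm (S w)"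
proof -
  obtain K where K: "0 \<le> K" and ev: "\<forall>\<^sub>F N in sequentially. \<forall>w. norm w = \<rho> / q ^ N \<longrightarrow>
     S w \<noteq> 0 \<and> norm (S (of_real q * w)) \<le> K * q ^ (2 * N) * norm (S w)"
    using assms unfolding separating_radius_def by blast
  show thesis by (rule that[OF K]; use ev in eventually_elim; blast)
qed

text \<open>Multiplication by \<open>q\<close> maps each circle to the preceding one, so the
  estimate can be iterated. Every iteration gains another factor, of which only one is kept.\<close>
lemma separating_radius_decay:
  assumes sr: "separating_radius \<rho>"
  shows "\<exists>K\<ge>0. \<forall>\<^sub>F N in sequentially. \<forall>w. norm w = \<rho> / q ^ N \<longrightarrow>
     norm (S (of_real q ^ Suc b * w)) \<le> K * q ^ (2 * N) * norm (S w)"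
proof (induction b)
  case 0
  obtain K1 where "K1 \<ge> 0" "\<forall>\<^sub>F N in sequentially. \<forall>w. norm w = \<rho> / q ^ N \<longrightarrow>
     norm (S (of_real q * w)) \<le> K1 * q ^ (2 * N) * norm (S w)"
    using separating_radiusE[OF sr] by blast
  then show ?case by (intro exI[of _ K1]) simp
next
  case (Suc b)
  then obtain K where K: "K \<ge> 0" "\<forall>\<^sub>F N in sequentially. \<forall>w. norm w = \<rho> / q ^ N \<longrightarrow>
     norm (S (of_real q ^ Suc b * w)) \<le> K * q ^ (2 * N) * norm (S w)" by blast
  obtain K1 where K1: "K1 \<ge> 0" "\<forall>\<^sub>F N in sequentially. \<forall>w. norm w = \<rho> / q ^ N \<longrightarrow>
     norm (S (of_real q * w)) \<le> K1 * q ^ (2 * N) * norm (S w)"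
    using separating_radiusE[OF sr] by blast
  have "\<forall>\<^sub>F N in sequentially. \<forall>w. norm w = \<rho> / q ^ (N - Suc b) \<longrightarrow>
     norm (S (of_real q * w)) \<le> K1 * q ^ (2 * (N - Suc b)) * norm (S w)"
    using K1(2) filterlim_minus_const_nat_at_top by (rule eventually_compose_filterlim)
  with K(2) eventually_ge_at_top[of "Suc b"]
  have "\<forall>\<^sub>F N in sequentially. \<forall>w. norm w = \<rho> / q ^ N \<longrightarrow>
     norm (S (of_real q ^ Suc (Suc b) * w)) \<le> (K1 * K) * q ^ (2 * N) * norm (S w)"
  proof (eventually_elim, intro allI impI)
    fix N and w :: complex
    assume IH: "\<forall>w. norm w = \<rho> / q ^ N \<longrightarrow> norm (S (of_real q ^ Suc b * w)) \<le> K * q ^ (2 * N) * norm (S w)"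
      and N: "Suc b \<le> N"
      and st: "\<forall>w. norm w = \<rho> / q ^ (N - Suc b) \<longrightarrow>
         norm (S (of_real q * w)) \<le> K1 * q ^ (2 * (N - Suc b)) * norm (S w)"
      and w: "norm w = \<rho> / q ^ N"
    have qN: "q ^ N = q ^ (N - Suc b) * q ^ Suc b" using N by (simp only: power_add[symmetric]) simp
    have "norm (of_real q ^ Suc b * w) = q ^ Suc b * (\<rho> / q ^ N)"
      unfolding norm_mult norm_power w using q_pos by simp
    also have "\<dots> = \<rho> / q ^ (N - Suc b)" unfolding qN using q_pos by simp
    finally have nw: "norm (of_real q ^ Suc b * w) = \<rho> / q ^ (N - Suc b)" .
    have "norm (S (of_real q ^ Suc (Suc b) * w)) = norm (S (of_real q * (of_real q ^ Suc b * w)))"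
      by (simp add: mult_ac)
    also have "\<dots> \<le> K1 * q ^ (2 * (N - Suc b)) * norm (S (of_real q ^ Suc b * w))"
      using st nw by blast
    also have "\<dots> \<le> K1 * 1 * (K * q ^ (2 * N) * norm (S w))"
      using K1(1) K(1) IH w q_pos q_less_1 by (intro mult_mono) (auto intro: power_le_one)
    finally show "norm (S (of_real q ^ Suc (Suc b) * w)) \<le> (K1 * K) * q ^ (2 * N) * norm (S w)"
      by (simp only: mult_ac mult_1)
  qed
  then show ?case using K(1) K1(1) by (intro exI[of _ "K1 * K"]) auto
qed

section \<open>The polynomials at the zeros\<close>

text \<open>The orthogonality points are \<open>h * z\<close> with \<open>S z = 0\<close>.\<close>
definition h :: real where "h = q powr (1/2)"

lemma h_pos: "0 < h" and h_sq: "h * h = q"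
  using q_pos by (simp_all add: h_def flip: powr_add)

text \<open>The polynomials at the rescaled complex argument \<open>h * w\<close>, defined by the
  recurrence itself so that complex values are available.\<close>
fun scaled_P :: "nat \<Rightarrow> complex \<Rightarrow> complex" where
  "scaled_P 0 w = 1"
| "scaled_P (Suc 0) w = of_real h * w"
| "scaled_P (Suc (Suc n)) w = of_real h ^ Suc n * (of_real h * w * scaled_P (Suc n) w - scaled_P n w / of_real h ^ n)"

lemma scaled_P_of_real: "scaled_P n (of_real t) = of_real (poly (qP q n) (h * t))"
proof (induction n rule: induct_nat_012)
  case (ge2 n)
  have hp: "q powr (real k / 2) = h ^ k" for k
    using q_pos by (simp add: h_def powr_powr flip: powr_realpow)
  have "q powr (real (Suc n) / 2) = h ^ Suc n" "q powr (- real n / 2) = 1 / h ^ n"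
    unfolding hp[symmetric] by (simp_all add: powr_minus_divide)
  then show ?case using ge2 by (simp only: scaled_P.simps qP.simps) (simp add: algebra_simps)
qed simp_all

lemma scaled_P_times_argument:
  "of_real h * w * scaled_P n w = scaled_P (Suc n) w / of_real h ^ n + (if n = 0 then 0 else scaled_P (n - 1) w / of_real h ^ (n - 1))"
  using h_pos by (cases n) (simp_all add: field_simps)

text \<open>The solution of the Jacobi recurrence at \<open>h * w\<close> whose even-indexed part
  dominates at infinity, which is the boundary condition of the self-adjoint extension in question.
  Continued to index \<open>-1\<close> it takes the value \<open>S w\<close>, so it is proportional
  to the polynomials exactly at the zeros of \<open>S\<close>.\<close>
definition Psi :: "nat \<Rightarrow> complex \<Rightarrow> complex" where
  "Psi n w = (if even n then of_real (- h) ^ (n div 2) * C (of_real q ^ (n div 2) * w)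
     else of_real (- h) ^ Suc (n div 2) * S (of_real q ^ Suc (n div 2) * w))"

lemma Psi_even: "Psi (2 * k) w = of_real (- h) ^ k * C (of_real q ^ k * w)"
  and Psi_odd: "Psi (Suc (2 * k)) w = of_real (- h) ^ Suc k * S (of_real q ^ Suc k * w)"
  by (simp_all add: Psi_def)

text \<open>This is \<open>C_diff\<close> for even \<open>n\<close> and \<open>S_diff\<close> for
  odd \<open>n\<close>.\<close>
lemma Psi_rec:
  "Psi (Suc (Suc n)) w = of_real h ^ Suc n * (of_real h * w * Psi (Suc n) w - Psi n w / of_real h ^ n)"
proof -
  define g where "g = complex_of_real h"
  have g0: "g \<noteq> 0" using h_pos by (simp add: g_def)
  have gq: "of_real q = g * g" by (simp add: g_def h_sq flip: of_real_mult)
  have mg: "complex_of_real (- h) = - g" by (simp add: g_def)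
  show ?thesis
  proof (cases "even n")
    case True
    then obtain k where n: "n = 2 * k" by blast
    define u where "u = complex_of_real q ^ k"
    have u: "g ^ (2 * k) = u" by (simp add: u_def gq power_mult power2_eq_square)
    have u0: "u \<noteq> 0" using q_pos by (simp add: u_def)
    have n2: "Suc (Suc (2 * k)) = 2 * Suc k" by simp
    have D1: "C (of_real q ^ Suc k * w) = C (u * w) + g * g * (u * w) * S (of_real q ^ Suc k * w)"
      using C_diff[of "u * w"] by (simp add: u_def mult.assoc gq[symmetric] algebra_simps)
    show ?thesis
      unfolding n unfolding n2 unfolding Psi_even Psi_odd mg D1 g_def[symmetric] power_Suc[of g] power_Suc[of "-g"] u u_def[symmetric]
      using u0 by (simp add: field_simps)
  next
    case False
    then obtain k where n: "n = Suc (2 * k)" by (metis oddE Suc_eq_plus1)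
    define u where "u = complex_of_real q ^ k"
    have u: "g ^ (2 * k) = u" by (simp add: u_def gq power_mult power2_eq_square)
    have u0: "u \<noteq> 0" using q_pos by (simp add: u_def)
    have n2: "Suc (Suc (2 * k)) = 2 * Suc k" by simp
    have u1: "g ^ Suc (2 * k) = g * u" and u2: "g ^ (2 * Suc k) = g * g * u"
      using u by (simp_all add: mult.assoc)
    have S2: "S (of_real q ^ Suc (Suc k) * w) = S (of_real q ^ Suc k * w) - g * g * u * w * C (of_real q ^ Suc k * w)"
      using S_diff[of "of_real q ^ Suc k * w"] by (simp add: u_def mult.assoc gq[symmetric] algebra_simps)
    show ?thesis
      unfolding n unfolding n2 unfolding Psi_even Psi_odd mg S2 g_def[symmetric] power_Suc[of "-g"] u1 u2
      using u0 g0 by (simp add: field_simps)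
  qed
qed

text \<open>Both sides satisfy the same recurrence, and
  \<open>Psi 1 z = h * z * Psi 0 z - h * S z\<close> shows that they share their first two values
  when \<open>S z = 0\<close>.\<close>
lemma Psi_at_zero:
  assumes "S z = 0"
  shows "Psi n z = C z * scaled_P n z"
proof (induction n rule: induct_nat_012)
  case 1
  have "S (of_real q * z) = S z - z * C z" by (simp flip: S_diff)
  then have "S (of_real q * z) = - (z * C z)" using assms by simp
  then show ?case using Psi_odd[of 0 z] by simp
next
  case (ge2 n)
  then show ?case unfolding Psi_rec scaled_P.simps by (simp add: algebra_simps)
qed (simp add: Psi_def)

lemma Psi_holo: "Psi n holomorphic_on A"
  unfolding Psi_def by (cases "even n") (auto intro!: holomorphic_intros S_scale_holo C_scale_holo simp del: power_Suc)

section \<open>Residue sums\<close>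

definition zeros_in :: "real \<Rightarrow> complex set" where
  "zeros_in r = {z. S z = 0 \<and> norm z < r}"

lemma S_not_constant: "\<not> S constant_on UNIV"
proof
  assume "S constant_on UNIV"
  then have "S z = S 0" for z unfolding constant_on_def by (elim exE) (simp del: S_0)
  then have "S = (\<lambda>z. 0)" by (intro ext) (simp only: S_0)
  then have "deriv S 0 = 0" by simp
  then show False using simple_zero_mass_pos(1)[of 0] by simp
qed

lemma finite_zeros_in: "finite (zeros_in r)"
proof -
  have "finite {z \<in> cball 0 r. S z = 0}"
    by (rule holomorphic_compact_finite_zeros[OF S_holo open_UNIV connected_UNIV _ _ S_not_constant]) auto
  then show ?thesis by (rule rev_finite_subset) (auto simp: zeros_in_def)
qed

text \<open>The disc of radius \<open>r + 1\<close> is an open neighbourhood of the contour; the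
  zeros between the contour and its boundary have winding number 0.\<close>
lemma residue_sum_nonvanishing:
  assumes F: "F holomorphic_on UNIV" and r: "0 < r" and nz: "\<And>w. norm w = r \<Longrightarrow> S w \<noteq> 0"
    and Fnz: "\<And>z. z \<in> zeros_in (r + 1) \<Longrightarrow> F z \<noteq> 0"
  shows "((\<lambda>w. F w / S w) has_contour_integral (2 * pi * \<i> * (\<Sum>z\<in>zeros_in r. F z / deriv S z))) (circlepath 0 r)"
proof -
  have int: "(\<lambda>w. F w / S w) contour_integrable_on circlepath 0 r"
    using r nz by (intro contour_integrable_continuous_circlepath continuous_intros
        holomorphic_on_imp_continuous_on holomorphic_on_subset[OF F] S_holo) auto
  have w1: "winding_number (circlepath 0 r) z = 1" if "z \<in> zeros_in r" for z
    using that by (intro winding_number_circlepath) (auto simp: zeros_in_def)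
  have w0: "winding_number (circlepath 0 r) z = 0" if "\<not> norm z \<le> r" for z
    using that r by (intro winding_number_zero_outside[of _ "cball 0 r"]) (auto simp: image_iff)
  have "contour_integral (circlepath 0 r) (\<lambda>w. F w / S w)
     = 2 * pi * \<i> * (\<Sum>z\<in>zeros_in (r + 1). winding_number (circlepath 0 r) z * residue (\<lambda>w. F w / S w) z)"
  proof (rule Residue_theorem[of "ball 0 (r + 1)"])
    show "(\<lambda>w. F w / S w) holomorphic_on ball 0 (r + 1) - zeros_in (r + 1)"
      by (intro holomorphic_intros holomorphic_on_subset[OF F] S_holo) (auto simp: zeros_in_def)
    show "path_image (circlepath 0 r) \<subseteq> ball 0 (r + 1) - zeros_in (r + 1)"
      using r nz by (auto simp: zeros_in_def)
    show "\<forall>z. z \<notin> ball 0 (r + 1) \<longrightarrow> winding_number (circlepath 0 r) z = 0"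
      using w0 by auto
  qed (auto simp: finite_zeros_in)
  also have "(\<Sum>z\<in>zeros_in (r + 1). winding_number (circlepath 0 r) z * residue (\<lambda>w. F w / S w) z)
      = (\<Sum>z\<in>zeros_in r. F z / deriv S z)"
  proof (rule sum.mono_neutral_cong_right)
    show "zeros_in r \<subseteq> zeros_in (r + 1)" by (auto simp: zeros_in_def)
    show "\<forall>z\<in>zeros_in (r + 1) - zeros_in r. winding_number (circlepath 0 r) z * residue (\<lambda>w. F w / S w) z = 0"
    proof
      fix z assume "z \<in> zeros_in (r + 1) - zeros_in r"
      then have "S z = 0" "\<not> norm z < r" by (auto simp: zeros_in_def)
      then have "\<not> norm z \<le> r" using nz[of z] by auto
      then show "winding_number (circlepath 0 r) z * residue (\<lambda>w. F w / S w) z = 0"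
        by (simp add: w0)
    qed
    show "winding_number (circlepath 0 r) z * residue (\<lambda>w. F w / S w) z = F z / deriv S z"
      if "z \<in> zeros_in r" for z
    proof -
      have Sz: "S z = 0" and z: "z \<in> zeros_in (r + 1)" using that by (auto simp: zeros_in_def)
      have "residue (\<lambda>w. F w / S w) z = F z / deriv S z"
        by (rule residue_simple_pole_deriv[OF F S_holo open_UNIV connected_UNIV UNIV_I S_has_deriv
              Fnz[OF z] Sz simple_zero_mass_pos(1)[OF Sz]])
      then show ?thesis using w1[OF that] by simp
    qed
  qed (rule finite_zeros_in)
  finally show ?thesis
    using has_contour_integral_integral[OF int] by simp
qed

text \<open>Adding a constant \<open>a\<close> to \<open>F\<close> makes it nonvanishing at the
  finitely many zeros of \<open>S\<close> concerned, so that all poles are genuine and simple; the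
  contribution of \<open>a / S\<close> is then subtracted.\<close>
lemma residue_sum:
  assumes F: "F holomorphic_on UNIV" and r: "0 < r" and nz: "\<And>w. norm w = r \<Longrightarrow> S w \<noteq> 0"
  shows "((\<lambda>w. F w / S w) has_contour_integral (2 * pi * \<i> * (\<Sum>z\<in>zeros_in r. F z / deriv S z))) (circlepath 0 r)"
proof -
  have "finite (insert 0 ((\<lambda>z. - F z) ` zeros_in (r + 1)))"
    by (simp add: finite_zeros_in)
  then obtain a where a: "a \<notin> insert 0 ((\<lambda>z. - F z) ` zeros_in (r + 1))"
    using ex_new_if_finite infinite_UNIV_char_0 by blast
  have "((\<lambda>w. (F w + a) / S w) has_contour_integral
      (2 * pi * \<i> * (\<Sum>z\<in>zeros_in r. (F z + a) / deriv S z))) (circlepath 0 r)"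
  proof (rule residue_sum_nonvanishing[OF _ r nz])
    show "F z + a \<noteq> 0" if "z \<in> zeros_in (r + 1)" for z
      using a that by (auto simp: image_iff add_eq_0_iff)
  qed (auto intro!: holomorphic_intros F)
  moreover have "((\<lambda>w. a / S w) has_contour_integral
      (2 * pi * \<i> * (\<Sum>z\<in>zeros_in r. a / deriv S z))) (circlepath 0 r)"
    by (rule residue_sum_nonvanishing[OF _ r nz]) (use a in auto)
  ultimately have "((\<lambda>w. (F w + a) / S w - a / S w) has_contour_integral
      (2 * pi * \<i> * (\<Sum>z\<in>zeros_in r. (F z + a) / deriv S z)
       - 2 * pi * \<i> * (\<Sum>z\<in>zeros_in r. a / deriv S z))) (circlepath 0 r)"
    by (rule has_contour_integral_diff)
  then show ?thesis
    by (simp add: add_divide_distrib sum.distrib distrib_left)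
qed

text \<open>On the circles \<open>F / S\<close> differs from \<open>\<kappa> / w\<close> by
  \<open>o(1 / norm w)\<close>, so the contour integral converges to that of
  \<open>\<kappa> / w\<close>.\<close>
lemma residue_sum_tendsto:
  assumes F: "F holomorphic_on UNIV" and sr: "separating_radius \<rho>"
    and K: "0 \<le> K" "\<forall>\<^sub>F N in sequentially. \<forall>w. norm w = \<rho> / q ^ N \<longrightarrow>
       norm (w * F w - \<kappa> * S w) \<le> K * q ^ N * norm (S w)"
  shows "(\<lambda>N. \<Sum>z\<in>zeros_in (\<rho> / q ^ N). F z / deriv S z) \<longlonglongrightarrow> \<kappa>"
proof -
  have \<rho>: "0 < \<rho>" using sr by (simp add: separating_radius_def)
  have ev: "\<forall>\<^sub>F N in sequentially. \<forall>w. norm w = \<rho> / q ^ N \<longrightarrow> S w \<noteq> 0"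
    using separating_radiusE[OF sr] by blast
  have "\<forall>\<^sub>F N in sequentially. norm ((\<Sum>z\<in>zeros_in (\<rho> / q ^ N). F z / deriv S z) - \<kappa>) \<le> K * q ^ N"
    using ev K(2)
  proof eventually_elim
    fix N
    assume nz: "\<forall>w. norm w = \<rho> / q ^ N \<longrightarrow> S w \<noteq> 0"
      and bd: "\<forall>w. norm w = \<rho> / q ^ N \<longrightarrow> norm (w * F w - \<kappa> * S w) \<le> K * q ^ N * norm (S w)"
    define r where "r = \<rho> / q ^ N"
    have r: "0 < r" using \<rho> q_pos by (simp add: r_def)
    define \<Sigma> where "\<Sigma> = (\<Sum>z\<in>zeros_in r. F z / deriv S z)"
    have i1: "((\<lambda>w. F w / S w) has_contour_integral (2 * pi * \<i> * \<Sigma>)) (circlepath 0 r)"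
      unfolding \<Sigma>_def using nz by (intro residue_sum F r) (simp add: r_def)
    have "(\<lambda>w. 1 / (w - 0)) contour_integrable_on circlepath 0 r"
      using r by (intro contour_integrable_continuous_circlepath continuous_intros) auto
    moreover have "contour_integral (circlepath 0 r) (\<lambda>w. 1 / (w - 0)) = 2 * pi * \<i>"
      using contour_integral_circlepath[OF r, of 0] by simp
    ultimately have "((\<lambda>w. 1 / (w - 0)) has_contour_integral (2 * pi * \<i>)) (circlepath 0 r)"
      using has_contour_integral_integral[of "\<lambda>w. 1 / (w - 0)" "circlepath 0 r"] by metis
    then have "((\<lambda>w. \<kappa> * (1 / (w - 0))) has_contour_integral (\<kappa> * (2 * pi * \<i>))) (circlepath 0 r)"
      by (rule has_contour_integral_lmul)
    with i1 have "((\<lambda>w. F w / S w - \<kappa> * (1 / (w - 0))) has_contour_integral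
        (2 * pi * \<i> * \<Sigma> - \<kappa> * (2 * pi * \<i>))) (circlepath 0 r)"
      by (rule has_contour_integral_diff)
    then have "norm (2 * pi * \<i> * \<Sigma> - \<kappa> * (2 * pi * \<i>)) \<le> K * q ^ N / r * (2 * pi * r)"
    proof (rule has_contour_integral_bound_circlepath)
      show "0 \<le> K * q ^ N / r" using K(1) q_pos r by simp
      fix w :: complex assume "norm (w - 0) = r"
      then have w: "norm w = r" by simp
      have Sw: "S w \<noteq> 0" and b: "norm (w * F w - \<kappa> * S w) \<le> K * q ^ N * norm (S w)"
        using nz bd w unfolding r_def by blast+
      have "w \<noteq> 0" using w r by auto
      then have "F w / S w - \<kappa> * (1 / (w - 0)) = (w * F w - \<kappa> * S w) / (w * S w)"
        using Sw by (simp add: field_simps)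
      also have "norm \<dots> \<le> K * q ^ N * norm (S w) / (r * norm (S w))"
        unfolding norm_divide norm_mult[of w "S w"] w using b r by (intro divide_right_mono) auto
      also have "\<dots> = K * q ^ N / r" using Sw by simp
      finally show "norm (F w / S w - \<kappa> * (1 / (w - 0))) \<le> K * q ^ N / r" .
    qed (rule r)
    also have "2 * pi * \<i> * \<Sigma> - \<kappa> * (2 * pi * \<i>) = 2 * pi * \<i> * (\<Sigma> - \<kappa>)"
      by (simp add: algebra_simps)
    finally have "2 * pi * norm (\<Sigma> - \<kappa>) \<le> 2 * pi * (K * q ^ N)"
      using r by (simp add: norm_mult)
    then show "norm ((\<Sum>z\<in>zeros_in (\<rho> / q ^ N). F z / deriv S z) - \<kappa>) \<le> K * q ^ N"
      unfolding \<Sigma>_def r_def by simp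
  qed
  moreover have "(\<lambda>N. K * q ^ N) \<longlonglongrightarrow> 0"
    using q_pos q_less_1 by (intro tendsto_mult_right_zero LIMSEQ_power_zero) auto
  ultimately have "(\<lambda>N. (\<Sum>z\<in>zeros_in (\<rho> / q ^ N). F z / deriv S z) - \<kappa>) \<longlonglongrightarrow> 0"
    by (rule Lim_null_comparison)
  then show ?thesis by (simp add: LIM_zero_iff)
qed

text \<open>By \<open>S_diff\<close>, \<open>w * Psi n w\<close> is built from dilates
  \<open>S (q ^ b * w)\<close>, which for \<open>b > 0\<close> are small against \<open>S w\<close>
  on the contours, even after multiplication by \<open>w\<close>. Only
  \<open>w * Psi 0 w = S w - S (q * w)\<close> contains \<open>S\<close> itself, whence the limit
  1.\<close>
lemma Psi_residue_sum_tendsto: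
  assumes sr: "separating_radius \<rho>"
  shows "(\<lambda>N. \<Sum>z\<in>zeros_in (\<rho> / q ^ N). Psi n z / deriv S z) \<longlonglongrightarrow> (if n = 0 then 1 else 0)"
proof -
  have \<rho>: "0 < \<rho>" using sr by (simp add: separating_radius_def)
  have q2: "q ^ (2 * N) \<le> q ^ N" for N using q_pos q_less_1 by (intro power_decreasing) auto
  have decay: "\<exists>K\<ge>0. \<forall>\<^sub>F N in sequentially. \<forall>w. norm w = \<rho> / q ^ N \<longrightarrow>
     norm (S (of_real q ^ Suc b * w)) \<le> K * q ^ (2 * N) * norm (S w)" for b
    by (rule separating_radius_decay[OF sr])
  consider "n = 0" | k where "n = 2 * Suc k" | k where "n = Suc (2 * k)"
    by (metis even_Suc evenE not0_implies_Suc oddE Suc_eq_plus1 mult_0_right)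
  then have "\<exists>K\<ge>0. \<forall>\<^sub>F N in sequentially. \<forall>w. norm w = \<rho> / q ^ N \<longrightarrow>
       norm (w * Psi n w - (if n = 0 then 1 else 0) * S w) \<le> K * q ^ N * norm (S w)"
  proof cases
    case 1
    obtain K where K: "0 \<le> K" "\<forall>\<^sub>F N in sequentially. \<forall>w. norm w = \<rho> / q ^ N \<longrightarrow>
       norm (S (of_real q ^ Suc 0 * w)) \<le> K * q ^ (2 * N) * norm (S w)" using decay by blast
    have "w * Psi n w - (if n = 0 then 1 else 0) * S w = - S (of_real q ^ Suc 0 * w)" for w
      using S_diff[of w] 1 by (simp add: Psi_def algebra_simps)
    then show ?thesis using K(1)
      by (intro exI[of _ K] conjI eventually_mono[OF K(2)])
         (auto intro: order_trans[OF _ mult_right_mono[OF mult_left_mono[OF q2]]])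
  next
    case (2 k)
    obtain K where K: "0 \<le> K" "\<forall>\<^sub>F N in sequentially. \<forall>w. norm w = \<rho> / q ^ N \<longrightarrow>
       norm (S (of_real q ^ Suc k * w)) \<le> K * q ^ (2 * N) * norm (S w)" using decay by blast
    obtain L where L: "0 \<le> L" "\<forall>\<^sub>F N in sequentially. \<forall>w. norm w = \<rho> / q ^ N \<longrightarrow>
       norm (S (of_real q ^ Suc (Suc k) * w)) \<le> L * q ^ (2 * N) * norm (S w)" using decay by blast
    define a where "a = h ^ Suc k / q ^ Suc k"
    have a: "0 \<le> a" using h_pos q_pos by (simp add: a_def)
    have eq: "w * Psi n w = (of_real (- h) ^ Suc k / of_real q ^ Suc k) * (S (of_real q ^ Suc k * w) - S (of_real q ^ Suc (Suc k) * w))" for w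
    proof -
      have "S (of_real q ^ Suc k * w) - S (of_real q ^ Suc (Suc k) * w) = of_real q ^ Suc k * w * C (of_real q ^ Suc k * w)"
        using S_diff[of "of_real q ^ Suc k * w"] by (simp add: mult.assoc)
      then show ?thesis unfolding 2 Psi_even using q_pos by simp
    qed
    have na: "norm (complex_of_real (- h) ^ Suc k / of_real q ^ Suc k) = a"
      unfolding norm_divide norm_power norm_of_real a_def using h_pos q_pos by simp
    have "\<forall>\<^sub>F N in sequentially. \<forall>w. norm w = \<rho> / q ^ N \<longrightarrow>
       norm (w * Psi n w - (if n = 0 then 1 else 0) * S w) \<le> a * (K + L) * q ^ N * norm (S w)"
      using K(2) L(2)
    proof (eventually_elim, intro allI impI)
      fix N and w :: complex
      assume "\<forall>w. norm w = \<rho> / q ^ N \<longrightarrow> norm (S (of_real q ^ Suc k * w)) \<le> K * q ^ (2 * N) * norm (S w)"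
        "\<forall>w. norm w = \<rho> / q ^ N \<longrightarrow> norm (S (of_real q ^ Suc (Suc k) * w)) \<le> L * q ^ (2 * N) * norm (S w)"
        and w: "norm w = \<rho> / q ^ N"
      then have b: "norm (S (of_real q ^ Suc k * w)) \<le> K * q ^ (2 * N) * norm (S w)"
         "norm (S (of_real q ^ Suc (Suc k) * w)) \<le> L * q ^ (2 * N) * norm (S w)" by blast+
      have "w * Psi n w - (if n = 0 then 1 else 0) * S w = w * Psi n w" using 2 by simp
      then have "norm (w * Psi n w - (if n = 0 then 1 else 0) * S w)
          = a * norm (S (of_real q ^ Suc k * w) - S (of_real q ^ Suc (Suc k) * w))"
        by (simp only: eq norm_mult na)
      also have "\<dots> \<le> a * (K * q ^ (2 * N) * norm (S w) + L * q ^ (2 * N) * norm (S w))"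
        using a b by (intro mult_left_mono order_trans[OF norm_triangle_ineq4] add_mono)
      also have "\<dots> = a * (K + L) * norm (S w) * q ^ (2 * N)"
        by (simp add: algebra_simps)
      also have "\<dots> \<le> a * (K + L) * norm (S w) * q ^ N"
        using a K(1) L(1) q2 by (intro mult_left_mono) auto
      finally show "norm (w * Psi n w - (if n = 0 then 1 else 0) * S w) \<le> a * (K + L) * q ^ N * norm (S w)"
        by (simp only: mult_ac)
    qed
    then show ?thesis using a K(1) L(1) by (intro exI[of _ "a * (K + L)"]) auto
  next
    case (3 k)
    obtain K where K: "0 \<le> K" "\<forall>\<^sub>F N in sequentially. \<forall>w. norm w = \<rho> / q ^ N \<longrightarrow>
       norm (S (of_real q ^ Suc k * w)) \<le> K * q ^ (2 * N) * norm (S w)" using decay by blast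
    have "\<forall>\<^sub>F N in sequentially. \<forall>w. norm w = \<rho> / q ^ N \<longrightarrow>
       norm (w * Psi n w - (if n = 0 then 1 else 0) * S w) \<le> \<rho> * h ^ Suc k * K * q ^ N * norm (S w)"
      using K(2)
    proof (eventually_elim, intro allI impI)
      fix N and w :: complex
      assume "\<forall>w. norm w = \<rho> / q ^ N \<longrightarrow> norm (S (of_real q ^ Suc k * w)) \<le> K * q ^ (2 * N) * norm (S w)"
        and w: "norm w = \<rho> / q ^ N"
      then have b: "norm (S (of_real q ^ Suc k * w)) \<le> K * q ^ (2 * N) * norm (S w)" by blast
      have "norm (w * Psi n w - (if n = 0 then 1 else 0) * S w)
          = \<rho> / q ^ N * (h ^ Suc k * norm (S (of_real q ^ Suc k * w)))"
        unfolding 3 Psi_odd using h_pos w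
        by (simp only: nat.distinct if_False mult_zero_left diff_zero norm_mult norm_power norm_of_real abs_minus_cancel abs_of_pos)
      also have "\<dots> \<le> \<rho> / q ^ N * (h ^ Suc k * (K * q ^ (2 * N) * norm (S w)))"
        using \<rho> h_pos q_pos b by (intro mult_left_mono) auto
      also have "\<dots> = \<rho> * h ^ Suc k * K * q ^ N * norm (S w)"
        using q_pos by (simp add: field_simps power_mult power2_eq_square power_mult_distrib mult_2 power_add)
      finally show "norm (w * Psi n w - (if n = 0 then 1 else 0) * S w) \<le> \<rho> * h ^ Suc k * K * q ^ N * norm (S w)" .
    qed
    then show ?thesis using \<rho> h_pos K(1) by (intro exI[of _ "\<rho> * h ^ Suc k * K"]) auto
  qed
  then obtain K where "0 \<le> K" "\<forall>\<^sub>F N in sequentially. \<forall>w. norm w = \<rho> / q ^ N \<longrightarrow>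
       norm (w * Psi n w - (if n = 0 then 1 else 0) * S w) \<le> K * q ^ N * norm (S w)" by blast
  then show ?thesis by (rule residue_sum_tendsto[OF Psi_holo sr])
qed

section \<open>Orthogonality\<close>

text \<open>At the zeros \<open>mass z * scaled_P n z\<close> is \<open>Psi n z / deriv S z\<close>,
  which settles \<open>m = 0\<close>. As in the proof that a three-term recurrence makes its
  polynomials orthogonal, the recurrence then moves degree from one factor to the other.\<close>
lemma scaled_P_residue_sum_tendsto:
  assumes sr: "separating_radius \<rho>"
  shows "(\<lambda>N. \<Sum>z\<in>zeros_in (\<rho> / q ^ N). mass z * (scaled_P n z * scaled_P m z)) \<longlonglongrightarrow> (if n = m then 1 else 0)"
proof -
  define \<Lambda> where "\<Lambda> = (\<lambda>f N. \<Sum>z\<in>zeros_in (\<rho> / q ^ N). mass z * f z)"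
  have add: "\<Lambda> (\<lambda>z. f z + g z) N = \<Lambda> f N + \<Lambda> g N" and diff: "\<Lambda> (\<lambda>z. f z - g z) N = \<Lambda> f N - \<Lambda> g N"
    and scale: "\<Lambda> (\<lambda>z. a * f z) N = a * \<Lambda> f N" for f g N a
    by (simp_all add: \<Lambda>_def algebra_simps sum.distrib sum_subtractf sum_distrib_left)
  have base: "\<Lambda> (scaled_P n) \<longlonglongrightarrow> (if n = 0 then 1 else 0)" for n
  proof -
    have "mass z * scaled_P n z = Psi n z / deriv S z" if "z \<in> zeros_in r" for z r
      using that Psi_at_zero[of z n] by (simp add: zeros_in_def mass_def)
    then show ?thesis
      using Psi_residue_sum_tendsto[OF sr, of n] unfolding \<Lambda>_def by (simp cong: sum.cong)
  qed
  have step: "\<Lambda> (\<lambda>z. of_real h * z * scaled_P n z * f z) \<longlonglongrightarrow>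
      a (Suc n) / of_real h ^ n + (if n = 0 then 0 else a (n - 1) / of_real h ^ (n - 1))"
    if lim: "\<And>n. \<Lambda> (\<lambda>z. scaled_P n z * f z) \<longlonglongrightarrow> a n" for f a n
  proof -
    have "(\<lambda>z. of_real h * z * scaled_P n z * f z) = (\<lambda>z. (1 / of_real h ^ n) * (scaled_P (Suc n) z * f z)
        + (if n = 0 then 0 else 1 / of_real h ^ (n - 1)) * (scaled_P (n - 1) z * f z))"
      by (rule ext, subst scaled_P_times_argument) (simp add: algebra_simps)
    then have "\<Lambda> (\<lambda>z. of_real h * z * scaled_P n z * f z) = (\<lambda>N. (1 / of_real h ^ n) * \<Lambda> (\<lambda>z. scaled_P (Suc n) z * f z) N
        + (if n = 0 then 0 else 1 / of_real h ^ (n - 1)) * \<Lambda> (\<lambda>z. scaled_P (n - 1) z * f z) N)"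
      by (intro ext) (simp only: add scale)
    moreover have "\<dots> \<longlonglongrightarrow> (1 / of_real h ^ n) * a (Suc n)
        + (if n = 0 then 0 else 1 / of_real h ^ (n - 1)) * a (n - 1)"
      by (intro tendsto_intros lim)
    ultimately show ?thesis by (auto split: if_splits)
  qed
  have h0: "complex_of_real h \<noteq> 0" using h_pos by simp
  have "\<Lambda> (\<lambda>z. scaled_P n z * scaled_P m z) \<longlonglongrightarrow> (if n = m then 1 else 0)"
  proof (induction m arbitrary: n rule: induct_nat_012)
    case 0
    then show ?case using base[of n] by simp
  next
    case 1
    have "(\<lambda>z. scaled_P n z * scaled_P (Suc 0) z) = (\<lambda>z. of_real h * z * scaled_P n z * 1)" by (simp add: mult_ac)
    moreover have "\<Lambda> (\<lambda>z. of_real h * z * scaled_P n z * 1) \<longlonglongrightarrow> (if Suc n = 0 then 1 else 0) / of_real h ^ n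
       + (if n = 0 then 0 else (if n - 1 = 0 then 1 else 0) / of_real h ^ (n - 1))"
      by (rule step) (use base in simp)
    ultimately show ?case by (cases n) (auto split: if_splits)
  next
    case (ge2 m)
    have "(\<lambda>z. scaled_P n z * scaled_P (Suc (Suc m)) z) = (\<lambda>z. of_real h ^ Suc m *
        (of_real h * z * scaled_P n z * scaled_P (Suc m) z - 1 / of_real h ^ m * (scaled_P n z * scaled_P m z)))"
      using h0 by (simp add: algebra_simps)
    then have "\<Lambda> (\<lambda>z. scaled_P n z * scaled_P (Suc (Suc m)) z) = (\<lambda>N. of_real h ^ Suc m *
        (\<Lambda> (\<lambda>z. of_real h * z * scaled_P n z * scaled_P (Suc m) z) N - 1 / of_real h ^ m * \<Lambda> (\<lambda>z. scaled_P n z * scaled_P m z) N))"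
      by (intro ext) (simp only: diff scale)
    moreover have "\<dots> \<longlonglongrightarrow> of_real h ^ Suc m *
        (((if Suc n = Suc m then 1 else 0) / of_real h ^ n
          + (if n = 0 then 0 else (if n - 1 = Suc m then 1 else 0) / of_real h ^ (n - 1)))
         - 1 / of_real h ^ m * (if n = m then 1 else 0))"
      by (intro tendsto_intros step[OF ge2(2)] ge2(1))
    moreover have "of_real h ^ Suc m *
        (((if Suc n = Suc m then 1 else 0) / of_real h ^ n
          + (if n = 0 then 0 else (if n - 1 = Suc m then 1 else 0) / of_real h ^ (n - 1)))
         - 1 / of_real h ^ m * (if n = m then 1 else 0)) = (if n = Suc (Suc m) then 1 else 0 :: complex)"
      using h0 by (cases n) auto
    ultimately show ?case by simp
  qed
  then show ?thesis unfolding \<Lambda>_def .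
qed

text \<open>For \<open>n = m\<close> the terms are nonnegative, so their convergence along the discs
  gives summability; the mixed terms are dominated by the diagonal ones.\<close>
lemma orthogonality_over_zeros:
  "((\<lambda>z. mass z * (scaled_P n z * scaled_P m z)) has_sum (if n = m then 1 else 0)) {z. S z = 0}"
proof -
  obtain \<rho> where sr: "separating_radius \<rho>" by (rule separating_radius_exists)
  then have \<rho>: "0 < \<rho>" by (simp add: separating_radius_def)
  define X where "X = (\<lambda>N. zeros_in (\<rho> / q ^ N))"
  have X1: "finite (X N)" for N by (simp add: X_def finite_zeros_in)
  have X2: "X N \<subseteq> {z. S z = 0}" for N by (auto simp: X_def zeros_in_def)
  have X3: "\<forall>\<^sub>F N in sequentially. z \<in> X N" if "z \<in> {z. S z = 0}" for z
  proof -
    have "(\<lambda>N. norm z * q ^ N) \<longlonglongrightarrow> 0"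
      using q_pos q_less_1 by (intro tendsto_mult_right_zero LIMSEQ_power_zero) auto
    then have "\<forall>\<^sub>F N in sequentially. norm z * q ^ N < \<rho>"
      by (rule order_tendstoD) (rule \<rho>)
    then show ?thesis
      by eventually_elim (use that q_pos in \<open>simp add: X_def zeros_in_def field_simps\<close>)
  qed
  have sq: "(\<lambda>z. norm (mass z * (scaled_P k z * scaled_P k z))) summable_on {z. S z = 0}" for k
  proof (rule nonneg_summable_of_exhaustion[OF _ X1 X2 X3])
    have "norm (mass z * (scaled_P k z * scaled_P k z)) = Re (mass z * (scaled_P k z * scaled_P k z))" if Sz: "S z = 0" for z
    proof -
      obtain r where r: "r > 0" "mass z = of_real r" using simple_zero_mass_pos(2)[OF Sz] by blast
      obtain t where t: "z = of_real t" using zeros_real[OF Sz] by (auto elim: Reals_cases)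
      have "mass z * (scaled_P k z * scaled_P k z) = of_real (r * (poly (qP q k) (h * t))\<^sup>2)"
        unfolding t scaled_P_of_real r(2)[unfolded t] by (simp add: power2_eq_square)
      then show ?thesis using r(1) by (simp only: norm_of_real Re_complex_of_real) simp
    qed
    then have "(\<Sum>z\<in>X N. norm (mass z * (scaled_P k z * scaled_P k z))) = Re (\<Sum>z\<in>X N. mass z * (scaled_P k z * scaled_P k z))" for N
      unfolding Re_sum by (intro sum.cong) (use X2 in auto)
    moreover have "(\<lambda>N. Re (\<Sum>z\<in>X N. mass z * (scaled_P k z * scaled_P k z))) \<longlonglongrightarrow> Re 1"
      using scaled_P_residue_sum_tendsto[OF sr, of k k] unfolding X_def by (intro tendsto_Re) simp
    ultimately show "(\<lambda>N. \<Sum>z\<in>X N. norm (mass z * (scaled_P k z * scaled_P k z))) \<longlonglongrightarrow> Re 1"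
      by simp
  qed auto
  have "(\<lambda>z. norm (mass z * (scaled_P n z * scaled_P m z))) summable_on {z. S z = 0}"
  proof (rule summable_on_comparison_test)
    show "(\<lambda>z. norm (mass z * (scaled_P n z * scaled_P n z)) + norm (mass z * (scaled_P m z * scaled_P m z))) summable_on {z. S z = 0}"
      by (intro summable_on_add sq)
    show "norm (mass z * (scaled_P n z * scaled_P m z)) \<le> norm (mass z * (scaled_P n z * scaled_P n z)) + norm (mass z * (scaled_P m z * scaled_P m z))" for z
    proof -
      define a b where "a = norm (scaled_P n z)" and "b = norm (scaled_P m z)"
      have "0 \<le> (a - b)\<^sup>2 + (a\<^sup>2 + b\<^sup>2)" by simp
      then have "a * b \<le> a * a + b * b" by (simp add: power2_eq_square algebra_simps)
      then have "norm (mass z) * (a * b) \<le> norm (mass z) * (a * a + b * b)"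
        by (intro mult_left_mono) auto
      then show ?thesis by (simp add: norm_mult a_def b_def distrib_left)
    qed
  qed auto
  then have "(\<lambda>z. mass z * (scaled_P n z * scaled_P m z)) summable_on {z. S z = 0}"
    by (rule abs_summable_summable)
  then show ?thesis
    using scaled_P_residue_sum_tendsto[OF sr, of n m] unfolding X_def[symmetric]
    by (intro has_sum_of_exhaustion[OF _ X1 X2 X3]) (auto simp: X_def)
qed

text \<open>Differentiating \<open>S z - S (q * z) = z * C z\<close> at 0 gives
  \<open>(1 - q) * deriv S 0 = 1\<close>.\<close>
lemma mass_at_0: "mass 0 = of_real (1 - q)"
proof -
  have "((\<lambda>z. S z - S (of_real q * z)) has_field_derivative (deriv S 0 - deriv S 0 * of_real q)) (at 0)"
    by (rule DERIV_diff[OF S_has_deriv DERIV_chain2[of S "deriv S 0" "\<lambda>z. of_real q * z"]])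
       (use S_has_deriv[of 0] in \<open>auto intro!: derivative_eq_intros\<close>)
  moreover have "((\<lambda>z. z * C z) has_field_derivative 1) (at 0)"
    by (auto intro!: derivative_eq_intros C_has_deriv)
  ultimately have "deriv S 0 - deriv S 0 * of_real q = 1"
    unfolding S_diff by (rule DERIV_unique)
  then have "deriv S 0 * (1 - of_real q) = 1" by (simp add: algebra_simps)
  then have "deriv S 0 = 1 / (1 - of_real q)"
    by (metis mult_zero_right nonzero_eq_divide_eq zero_neq_one)
  then show ?thesis by (simp add: mass_def)
qed

lemma mass_eq:
  assumes "S z = 0" "z \<noteq> 0"
  shows "S (of_real q * z) / (z * deriv S z) = - mass z"
proof -
  have "S (of_real q * z) = S z - z * C z" by (simp flip: S_diff)
  then show ?thesis using assms by (simp add: mass_def)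
qed

end

theorem proposition16:
  fixes q :: real and s :: "int \<Rightarrow> real" and m n :: nat
  assumes "0 < q" and "q < 1"
    and "strict_mono_on {1..} s"
    and "s ` {1..} = {x. 0 < x \<and> qsin q (of_real x) = 0}"
    and "\<And>k. 1 \<le> k \<Longrightarrow> s (- k) = - s k"
  shows "(\<lambda>k. qsin q (of_real (q * s k)) / (of_real (s k) * deriv (qsin q) (of_real (s k)))
              * of_real (poly (qP q n) (q powr (1/2) * s k))
              * of_real (poly (qP q m) (q powr (1/2) * s k))) summable_on (UNIV - {0})
    \<and> of_real ((1 - q) * poly (qP q n) 0 * poly (qP q m) 0)
        - (\<Sum>\<^sub>\<infinity>k\<in>UNIV - {0}.
             qsin q (of_real (q * s k)) / (of_real (s k) * deriv (qsin q) (of_real (s k)))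
              * of_real (poly (qP q n) (q powr (1/2) * s k))
              * of_real (poly (qP q m) (q powr (1/2) * s k)))
      = (if m = n then 1 else 0)"
proof -
  interpret q_trig q using assms(1,2) by unfold_locales
  define \<phi> where "\<phi> = (\<lambda>k. complex_of_real (s k))"
  define f where "f = (\<lambda>z. mass z * (scaled_P n z * scaled_P m z))"
  have pos: "0 < s k \<and> S (of_real (s k)) = 0" if "1 \<le> k" for k
    using assms(4) that unfolding S_def by (metis (mono_tags, lifting) atLeast_iff imageI mem_Collect_eq)
  have neg: "s k < 0 \<and> S (of_real (s k)) = 0" if "k \<le> -1" for k
    using pos[of "- k"] assms(5)[of "- k"] that S_uminus[of "of_real (s (- k))"] by simp
  have cases: "1 \<le> k \<or> k \<le> -1" if "k \<noteq> 0" for k :: int using that by linarith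
  have zero: "S (\<phi> k) = 0 \<and> \<phi> k \<noteq> 0" if "k \<noteq> 0" for k
    using cases[OF that] pos[of k] neg[of k] by (auto simp: \<phi>_def)
  have img: "\<phi> ` (UNIV - {0}) = {z. S z = 0} - {0}"
  proof
    show "\<phi> ` (UNIV - {0}) \<subseteq> {z. S z = 0} - {0}" using zero by auto
    show "{z. S z = 0} - {0} \<subseteq> \<phi> ` (UNIV - {0})"
    proof
      fix z assume "z \<in> {z. S z = 0} - {0}"
      then have z: "S z = 0" "z \<noteq> 0" by auto
      obtain t where t: "z = of_real t" using zeros_real[OF z(1)] by (auto elim: Reals_cases)
      have "S (of_real \<bar>t\<bar>) = 0"
        using z(1) S_uminus[of z] by (cases "t < 0") (simp_all add: t)
      then have "\<bar>t\<bar> \<in> s ` {1..}" using z(2) unfolding assms(4) S_def[symmetric] by (simp add: t)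
      then obtain k where k: "1 \<le> k" "\<bar>t\<bar> = s k" by auto
      have "t = s k \<or> t = s (- k)" using k assms(5)[OF k(1)] by linarith
      then show "z \<in> \<phi> ` (UNIV - {0})" using k(1) unfolding \<phi>_def t by auto
    qed
  qed
  have inj: "inj_on \<phi> (UNIV - {0})"
  proof (rule inj_onI)
    have pp: "k = l" if "1 \<le> k" "1 \<le> l" "s k = s l" for k l
      using strict_mono_on_imp_inj_on[OF assms(3)] that by (auto dest: inj_onD)
    fix k l :: int assume "k \<in> UNIV - {0}" "l \<in> UNIV - {0}" and "\<phi> k = \<phi> l"
    then have kl: "k \<noteq> 0" "l \<noteq> 0" and eq: "s k = s l" by (auto simp: \<phi>_def)
    show "k = l"
    proof (cases "1 \<le> k")
      case True
      then have "1 \<le> l" using pos[of k] neg[of l] cases[OF kl(2)] eq by auto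
      then show ?thesis using pp True eq by blast
    next
      case False
      then have k: "k \<le> -1" using cases[OF kl(1)] by auto
      then have l: "l \<le> -1" using neg[of k] pos[of l] cases[OF kl(2)] eq by auto
      have "s (- k) = s (- l)" using k l eq assms(5)[of "- k"] assms(5)[of "- l"] by simp
      then show ?thesis using pp[of "- k" "- l"] k l by simp
    qed
  qed
  \<comment> \<open>the zero at the origin carries the term with \<open>1 - q\<close>; the sum over \<open>k\<close> is what is left\<close>
  have "(f has_sum (if n = m then 1 else 0)) {z. S z = 0}"
    unfolding f_def by (rule orthogonality_over_zeros)
  moreover have "(f has_sum f 0) {0}" using has_sum_finite[of "{0}" f] by simp
  ultimately have "(f has_sum ((if n = m then 1 else 0) - f 0)) ({z. S z = 0} - {0})"
    by (rule has_sum_Diff) simp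
  then have "((\<lambda>k. f (\<phi> k)) has_sum ((if n = m then 1 else 0) - f 0)) (UNIV - {0})"
    unfolding img[symmetric] using has_sum_reindex[OF inj, of f] by (simp add: comp_def)
  then have "((\<lambda>k. - f (\<phi> k)) has_sum - ((if n = m then 1 else 0) - f 0)) (UNIV - {0})"
    by (subst has_sum_uminus) (simp only: minus_minus)
  moreover have "- f (\<phi> k) = qsin q (of_real (q * s k)) / (of_real (s k) * deriv (qsin q) (of_real (s k)))
              * of_real (poly (qP q n) (q powr (1/2) * s k))
              * of_real (poly (qP q m) (q powr (1/2) * s k))" if "k \<in> UNIV - {0}" for k
    using mass_eq[of "\<phi> k"] zero[of k] that
    unfolding f_def \<phi>_def scaled_P_of_real h_def[symmetric] S_def[symmetric] of_real_mult by simp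
  ultimately have sum: "((\<lambda>k. qsin q (of_real (q * s k)) / (of_real (s k) * deriv (qsin q) (of_real (s k)))
              * of_real (poly (qP q n) (q powr (1/2) * s k))
              * of_real (poly (qP q m) (q powr (1/2) * s k))) has_sum - ((if n = m then 1 else 0) - f 0)) (UNIV - {0})"
    by (rule has_sum_cong[THEN iffD1, rotated])
  have f0: "f 0 = of_real ((1 - q) * poly (qP q n) 0 * poly (qP q m) 0)"
    using scaled_P_of_real[of n 0] scaled_P_of_real[of m 0] by (simp add: f_def mass_at_0)
  show ?thesis
    unfolding infsumI[OF sum] f0[symmetric]
    by (intro conjI has_sum_imp_summable[OF sum]) (cases "m = n"; simp)
qed

end
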